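(* Let $\Bbbk$ be a field of characteristic zero and let $n\ge 1$ be an integer. Then the border Waring rank of the monomial $x_1x_2\cdots x_n\in \Bbbk[x_1,\dots,x_n]_n$ is $$\underline{\mathbf{WR}}(x_1x_2\cdots x_n)=2^{n-1}.$$ Equivalently, the $n\times n$ permanent tensor $\operatorname{perm}_n=\sum_{\sigma\in\mathfrak{S}_n}e_{\sigma(1)}\otimes e_{\sigma(2)}\otimes\cdots\otimes e_{\sigma(n)}\in (\Bbbk^n)^{\otimes n}$, regarded as a symmetric tensor, satisfies $\underline{\mathbf{WR}}(\operatorname{perm}_n)=2^{n-1}$.
   Context: $\Bbbk$ is a field of characteristic zero, and $\Bbbk[x_1,\dots,x_n]_d$ denotes the $\Bbbk$-vector space of homogeneous polynomials of degree $d$ (called $d$-forms) in $x_1,\dots,x_n$. The Waring rank $\mathbf{WR}(f)$ of $f\in\Bbbk[x_1,\dots,x_n]_d$ is the smallest integer $r$ such that $f=a_1\ell_1^d+\cdots+a_r\ell_r^d$ for some linear forms $\ell_1,\dots,\ell_r\in\Bbbk[x_1,\dots,x_n]_1$ and scalars $a_1,\dots,a_r\in\Bbbk$. The border Waring rank $\underline{\mathbf{WR}}(f)$ of $f\in\Bbbk[x_1,\dots,x_n]_d$ is the smallest integer $r$ such that $f$ lies in the Zariski closure (in the affine space $\Bbbk[x_1,\dots,x_n]_d$) of the set of $d$-forms of Waring rank at most $r$. Let $V=\Bbbk^n$ with standard basis $e_1,\dots,e_n$, and let $\mathfrak{S}_d$ denote the symmetric group on $d$ letters. Homogeneous polynomials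 of degree $d$ in $x_1,\dots,x_n$ are identified with symmetric tensors in $V^{\otimes d}$ by setting $x_i=e_i$ and sending a product $v_1\cdots v_d$ of elements $v_i\in V$ to $\sum_{\sigma\in\mathfrak{S}_d}v_{\sigma(1)}\otimes\cdots\otimes v_{\sigma(d)}$. Under this identification $x_1x_2\cdots x_n$ corresponds to $\operatorname{perm}_n$, and the border Waring rank of a symmetric tensor means that of the corresponding homogeneous polynomial. *)

theory Defs
  imports "HOL-Library.Poly_Mapping" "HOL-Library.Extended_Nat" "HOL-Library.FuncSet"
    "HOL-Combinatorics.Permutations"
begin

section \<open>Polynomials and forms\<close>

text \<open>
  Polynomials over \<open>'a\<close> with variables indexed by \<open>'v\<close> are finitely supported maps from monomials
  (finitely supported exponent vectors) to coefficients. The variables \<open>x\<^sub>1, \<dots>, x\<^sub>n\<close>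
  are numbered \<open>0, \<dots>, n - 1\<close>.
\<close>

type_synonym ('v, 'a) mpoly = "('v \<Rightarrow>\<^sub>0 nat) \<Rightarrow>\<^sub>0 'a"

definition Var :: "'v \<Rightarrow> ('v, 'a::comm_ring_1) mpoly" where
  "Var i = Poly_Mapping.single (Poly_Mapping.single i 1) 1"

definition Const :: "'a::comm_ring_1 \<Rightarrow> ('v, 'a) mpoly" where
  "Const c = Poly_Mapping.single 0 c"

definition mpoly_eval :: "('v \<Rightarrow> 'a::comm_ring_1) \<Rightarrow> ('v, 'a) mpoly \<Rightarrow> 'a" where
  "mpoly_eval x p =
     (\<Sum>m\<in>Poly_Mapping.keys p. Poly_Mapping.lookup p m *
        (\<Prod>v\<in>Poly_Mapping.keys m. x v ^ Poly_Mapping.lookup m v))"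

definition mdegree :: "('v \<Rightarrow>\<^sub>0 nat) \<Rightarrow> nat" where
  "mdegree m = (\<Sum>v\<in>Poly_Mapping.keys m. Poly_Mapping.lookup m v)"

definition monomials :: "nat \<Rightarrow> nat \<Rightarrow> (nat \<Rightarrow>\<^sub>0 nat) set" where
  "monomials n d = {m. Poly_Mapping.keys m \<subseteq> {..<n} \<and> mdegree m = d}"

definition forms :: "nat \<Rightarrow> nat \<Rightarrow> (nat, 'a::comm_ring_1) mpoly set" where
  "forms n d = {f. Poly_Mapping.keys f \<subseteq> monomials n d}"


section \<open>Waring rank and border Waring rank\<close>

text \<open>
  The infimum of a set of extended naturals is its least element, or \<open>\<infinity>\<close> if the set is empty.
\<close>

definition waring_rank :: "nat \<Rightarrow> nat \<Rightarrow> (nat, 'a::field_char_0) mpoly \<Rightarrow> enat" where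
  "waring_rank n d f =
     Inf {enat r | r. \<exists>a l. (\<forall>i<r. l i \<in> forms n 1) \<and> f = (\<Sum>i<r. Const (a i) * l i ^ d)}"

text \<open>
  The space of \<open>d\<close>-forms is an affine space whose coordinates are the coefficients of a form.
  Its coordinate ring therefore consists of the polynomials in variables indexed by
  the monomials of degree \<open>d\<close>, and such a polynomial is evaluated at a form \<open>f\<close> by evaluating
  it at the coefficient function of \<open>f\<close>.
\<close>

definition zariski_closed :: "nat \<Rightarrow> nat \<Rightarrow> (nat, 'a::field_char_0) mpoly set \<Rightarrow> bool" where
  "zariski_closed n d Z \<longleftrightarrow>
     (\<exists>P :: (nat \<Rightarrow>\<^sub>0 nat, 'a) mpoly set.
        (\<forall>p\<in>P. \<forall>t\<in>Poly_Mapping.keys p. Poly_Mapping.keys t \<subseteq> monomials n d) \<and>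
        Z = {f \<in> forms n d. \<forall>p\<in>P. mpoly_eval (Poly_Mapping.lookup f) p = 0})"

definition zariski_closure ::
    "nat \<Rightarrow> nat \<Rightarrow> (nat, 'a::field_char_0) mpoly set \<Rightarrow> (nat, 'a) mpoly set" where
  "zariski_closure n d S = \<Inter> {Z. zariski_closed n d Z \<and> S \<subseteq> Z}"

definition border_waring_rank :: "nat \<Rightarrow> nat \<Rightarrow> (nat, 'a::field_char_0) mpoly \<Rightarrow> enat" where
  "border_waring_rank n d f =
     Inf {enat r | r. f \<in> zariski_closure n d {g \<in> forms n d. waring_rank n d g \<le> enat r}}"


section \<open>Symmetric tensors\<close>

text \<open>
  A tensor in the \<open>d\<close>-th tensor power of \<open>V\<close> (the \<open>n\<close>-dimensional coordinate space) is given by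
  its coordinates: the value at a word \<open>[i\<^sub>1, \<dots>, i\<^sub>d]\<close> is the coefficient of the tensor product
  of the basis vectors with indices \<open>i\<^sub>1, \<dots>, i\<^sub>d\<close>. Other words have value \<open>0\<close>.
\<close>

type_synonym 'a tensor = "nat list \<Rightarrow> 'a"

definition pure_tensor :: "nat \<Rightarrow> (nat \<Rightarrow> nat \<Rightarrow> 'a::comm_ring_1) \<Rightarrow> 'a tensor" where
  "pure_tensor d v = (\<lambda>u. if length u = d then \<Prod>j<d. v j (u ! j) else 0)"

definition basis_vec :: "nat \<Rightarrow> nat \<Rightarrow> 'a::comm_ring_1" where
  "basis_vec i = (\<lambda>k. if k = i then 1 else 0)"

definition perm_tensor :: "nat \<Rightarrow> 'a::comm_ring_1 tensor" where
  "perm_tensor n =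
     (\<lambda>u. \<Sum>\<sigma> | \<sigma> permutes {..<n}. pure_tensor n (\<lambda>j. basis_vec (\<sigma> j)) u)"

text \<open>
  The identification of forms with symmetric tensors is defined on monomials, each written as a
  product of variables, and extended linearly. Lemma \<open>form_to_tensor_prod\<close> below shows that
  it sends every product of linear forms, not only of variables, to the symmetrized tensor product.
\<close>

definition mono_word :: "(nat \<Rightarrow>\<^sub>0 nat) \<Rightarrow> nat list" where
  "mono_word m =
     concat (map (\<lambda>i. replicate (Poly_Mapping.lookup m i) i) (sorted_list_of_set (Poly_Mapping.keys m)))"

definition form_to_tensor :: "nat \<Rightarrow> (nat, 'a::comm_ring_1) mpoly \<Rightarrow> 'a tensor" where
  "form_to_tensor d f =
     (\<lambda>u. \<Sum>m\<in>Poly_Mapping.keys f. Poly_Mapping.lookup f m *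
        (\<Sum>\<sigma> | \<sigma> permutes {..<d}. pure_tensor d (\<lambda>j. basis_vec (mono_word m ! \<sigma> j)) u))"

text \<open>Uniqueness of the form below is lemma \<open>form_to_tensor_inj\<close>.\<close>

definition tensor_to_form :: "nat \<Rightarrow> nat \<Rightarrow> 'a::field_char_0 tensor \<Rightarrow> (nat, 'a) mpoly" where
  "tensor_to_form n d t = (THE f. f \<in> forms n d \<and> form_to_tensor d f = t)"

definition tensor_border_waring_rank :: "nat \<Rightarrow> nat \<Rightarrow> 'a::field_char_0 tensor \<Rightarrow> enat" where
  "tensor_border_waring_rank n d t = border_waring_rank n d (tensor_to_form n d t)"


subsection \<open>Correctness of the identification\<close>

lemma count_mono_word: "count (mset (mono_word m)) i = Poly_Mapping.lookup m i"
proof -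
  have *: "count (mset (concat (map (\<lambda>i. replicate (Poly_Mapping.lookup m i) i) xs))) i =
      (if i \<in> set xs then Poly_Mapping.lookup m i else 0)" if "distinct xs" for xs
    using that by (induction xs) auto
  show ?thesis
    unfolding mono_word_def by (subst *) (auto simp: in_keys_iff)
qed

lemma lookup_sum_single:
  "Poly_Mapping.lookup (\<Sum>j<d. Poly_Mapping.single (w ! j) (1::nat)) i =
     count (mset w) i" if "length w = d"
proof -
  have "Poly_Mapping.lookup (\<Sum>j<d. Poly_Mapping.single (w ! j) (1::nat)) i =
      (\<Sum>j<d. if w ! j = i then 1 else 0)"
    unfolding lookup_sum by (intro sum.cong) (auto simp: lookup_single when_def)
  also have "\<dots> = card {j. j < d \<and> w ! j = i}"
    by (simp add: sum.If_cases Int_def)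
  also have "\<dots> = count (mset w) i"
    using that by (simp add: count_mset count_list_eq_length_filter length_filter_conv_card eq_commute)
  finally show ?thesis .
qed

lemma mset_mono_word:
  assumes "length w = d"
  shows "mset (mono_word (\<Sum>j<d. Poly_Mapping.single (w ! j) 1)) = mset w"
  by (rule multiset_eqI) (simp only: count_mono_word lookup_sum_single[OF assms])

lemma sum_permutes_nth_cong:
  assumes "mset w = mset w'" "length w = d"
  shows "(\<Sum>\<sigma> | \<sigma> permutes {..<d}. pure_tensor d (\<lambda>j. basis_vec (w ! \<sigma> j)) u) =
         (\<Sum>\<sigma> | \<sigma> permutes {..<d}. pure_tensor d (\<lambda>j. basis_vec (w' ! \<sigma> j)) u)"
proof -
  obtain \<pi> where p: "\<pi> permutes {..<length w'}" "permute_list \<pi> w' = w"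
    using mset_eq_permutation[OF assms(1)] by metis
  have len: "length w' = d"
    using assms mset_eq_length by metis
  have "(\<Sum>\<sigma> | \<sigma> permutes {..<d}. pure_tensor d (\<lambda>j. basis_vec (w' ! \<sigma> j)) u) =
      (\<Sum>\<sigma> | \<sigma> permutes {..<d}. pure_tensor d (\<lambda>j. basis_vec (w' ! (\<pi> \<circ> \<sigma>) j)) u)"
    using p(1) len by (intro setum_permutations_compose_left) simp
  also have "\<dots> = (\<Sum>\<sigma> | \<sigma> permutes {..<d}. pure_tensor d (\<lambda>j. basis_vec (w ! \<sigma> j)) u)"
  proof (rule sum.cong[OF refl])
    fix \<sigma> assume "\<sigma> \<in> {\<sigma>. \<sigma> permutes {..<d}}"
    then have "\<sigma> j < d" if "j < d" for j
      using that permutes_in_image[of \<sigma> "{..<d}" j] by auto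
    then have "w' ! (\<pi> (\<sigma> j)) = w ! \<sigma> j" if "j < d" for j
      using that p len permute_list_nth[of \<pi> w' "\<sigma> j"] by auto
    then show "pure_tensor d (\<lambda>j. basis_vec (w' ! (\<pi> \<circ> \<sigma>) j)) u =
        pure_tensor d (\<lambda>j. basis_vec (w ! \<sigma> j)) u"
      by (auto simp: pure_tensor_def intro!: prod.cong)
  qed
  finally show ?thesis ..
qed

lemma form_to_tensor_superset:
  assumes "finite M" "Poly_Mapping.keys f \<subseteq> M"
  shows "form_to_tensor d f u = (\<Sum>m\<in>M. Poly_Mapping.lookup f m *
        (\<Sum>\<sigma> | \<sigma> permutes {..<d}. pure_tensor d (\<lambda>j. basis_vec (mono_word m ! \<sigma> j)) u))"
  unfolding form_to_tensor_def using assms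
  by (intro sum.mono_neutral_left) (auto simp: in_keys_iff)

lemma form_to_tensor_add:
  "form_to_tensor d (f + g) u = form_to_tensor d f u + form_to_tensor d g u"
proof -
  let ?M = "Poly_Mapping.keys f \<union> Poly_Mapping.keys g"
  have "Poly_Mapping.keys (f + g) \<subseteq> ?M"
    by (rule keys_add)
  then show ?thesis
    by (simp add: form_to_tensor_superset[of ?M] lookup_add ring_distribs sum.distrib)
qed

lemma form_to_tensor_sum:
  "form_to_tensor d (sum f A) u = (\<Sum>i\<in>A. form_to_tensor d (f i) u)"
proof (induction A rule: infinite_finite_induct)
  case (insert x F)
  then show ?case by (simp add: form_to_tensor_add)
qed (simp_all add: form_to_tensor_def)

lemma form_to_tensor_single:
  "form_to_tensor d (Poly_Mapping.single m c) u = c *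
     (\<Sum>\<sigma> | \<sigma> permutes {..<d}. pure_tensor d (\<lambda>j. basis_vec (mono_word m ! \<sigma> j)) u)"
  by (subst form_to_tensor_superset[of "{m}"]) auto

lemma mdegree_1:
  assumes "mdegree m = 1"
  obtains i where "m = Poly_Mapping.single i 1"
proof -
  have "m \<noteq> 0"
    using assms by (auto simp: mdegree_def)
  then obtain i where i: "i \<in> Poly_Mapping.keys m"
    using keys_eq_empty by blast
  have "mdegree m = Poly_Mapping.lookup m i + (\<Sum>v\<in>Poly_Mapping.keys m - {i}. Poly_Mapping.lookup m v)"
    unfolding mdegree_def using i by (simp add: sum.remove)
  moreover have "Poly_Mapping.lookup m i \<noteq> 0"
    using i by (simp add: in_keys_iff)
  ultimately have 1: "Poly_Mapping.lookup m i = 1"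
    "(\<Sum>v\<in>Poly_Mapping.keys m - {i}. Poly_Mapping.lookup m v) = 0"
    using assms by linarith+
  have "Poly_Mapping.lookup m v = 0" if "v \<noteq> i" for v
    using 1(2) that by (cases "v \<in> Poly_Mapping.keys m") (auto simp: in_keys_iff sum_eq_0_iff simp del: not_gr_zero)
  with 1(1) have "m = Poly_Mapping.single i 1"
    by (intro poly_mapping_eqI) (auto simp: lookup_single when_def)
  then show thesis
    using that by blast
qed

abbreviation (input) linear_coord :: "(nat, 'a::comm_ring_1) mpoly \<Rightarrow> nat \<Rightarrow> 'a" where
  "linear_coord l i \<equiv> Poly_Mapping.lookup l (Poly_Mapping.single i 1)"

lemma single_Suc_0_eq_iff:
  "Poly_Mapping.single i (Suc 0) = Poly_Mapping.single k (Suc 0) \<longleftrightarrow> i = k"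
proof
  assume "Poly_Mapping.single i (Suc 0) = Poly_Mapping.single k (Suc 0)"
  then have "Poly_Mapping.keys (Poly_Mapping.single i (Suc 0)) = Poly_Mapping.keys (Poly_Mapping.single k (Suc 0))"
    by (rule arg_cong)
  then show "i = k" by simp
qed simp

lemma linear_form_expand:
  assumes "l \<in> forms n 1"
  shows "l = (\<Sum>i<n. Poly_Mapping.single (Poly_Mapping.single i 1) (linear_coord l i))"
proof (rule poly_mapping_eqI)
  fix m
  show "Poly_Mapping.lookup l m = Poly_Mapping.lookup
      (\<Sum>i<n. Poly_Mapping.single (Poly_Mapping.single i 1) (linear_coord l i)) m"
  proof (cases "m \<in> Poly_Mapping.keys l")
    case True
    then have "m \<in> monomials n 1"
      using assms by (auto simp: forms_def)
    then have "mdegree m = 1" "Poly_Mapping.keys m \<subseteq> {..<n}"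
      by (auto simp: monomials_def)
    moreover from this(1) obtain k where "m = Poly_Mapping.single k 1"
      by (rule mdegree_1)
    ultimately have k: "m = Poly_Mapping.single k 1" "k < n"
      by auto
    then show ?thesis
      by (simp add: lookup_sum lookup_single when_def single_Suc_0_eq_iff)
  next
    case False
    then have "Poly_Mapping.lookup l m = 0"
      by (simp add: in_keys_iff)
    then show ?thesis
      by (auto simp: lookup_sum lookup_single when_def intro!: sum.neutral)
  qed
qed

lemma prod_single:
  "finite A \<Longrightarrow> (\<Prod>j\<in>A. Poly_Mapping.single (k j) (c j)) =
     (Poly_Mapping.single (\<Sum>j\<in>A. k j) (\<Prod>j\<in>A. c j) :: ('v, 'a::comm_ring_1) mpoly)"
  by (induction A rule: finite_induct) (simp_all add: mult_single)

lemma form_to_tensor_monomial: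
  fixes c :: "'a::comm_ring_1"
  shows "form_to_tensor d (Poly_Mapping.single (\<Sum>j<d. Poly_Mapping.single (g j) 1) c) u =
     c * (\<Sum>\<sigma> | \<sigma> permutes {..<d}. pure_tensor d (\<lambda>j. basis_vec (g (\<sigma> j))) u)"
proof -
  let ?w = "map g [0..<d]"
  have m: "(\<Sum>j<d. Poly_Mapping.single (g j) 1) = (\<Sum>j<d. Poly_Mapping.single (?w ! j) (1::nat))"
    by (intro sum.cong) auto
  have w: "mset (mono_word (\<Sum>j<d. Poly_Mapping.single (g j) 1)) = mset ?w"
    unfolding m by (rule mset_mono_word) simp
  then have len: "length (mono_word (\<Sum>j<d. Poly_Mapping.single (g j) 1)) = d"
    by (metis length_map length_upt minus_nat.diff_0 size_mset)
  have "(\<Sum>\<sigma> | \<sigma> permutes {..<d}. pure_tensor d (\<lambda>j. basis_vec (?w ! \<sigma> j)) u) =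
      (\<Sum>\<sigma> | \<sigma> permutes {..<d}. pure_tensor d (\<lambda>j. basis_vec (g (\<sigma> j))) u :: 'a)"
  proof (rule sum.cong[OF refl])
    fix \<sigma> assume "\<sigma> \<in> {\<sigma>. \<sigma> permutes {..<d}}"
    then have "\<sigma> j < d" if "j < d" for j
      using that permutes_in_image[of \<sigma> "{..<d}" j] by auto
    then show "pure_tensor d (\<lambda>j. basis_vec (?w ! \<sigma> j)) u = (pure_tensor d (\<lambda>j. basis_vec (g (\<sigma> j))) u :: 'a)"
      by (auto simp: pure_tensor_def intro!: prod.cong)
  qed
  then show ?thesis
    unfolding form_to_tensor_single sum_permutes_nth_cong[OF w len] by simp
qed

lemma form_to_tensor_prod:
  assumes l: "\<And>j. j < d \<Longrightarrow> l j \<in> forms n 1"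
  shows "form_to_tensor d (\<Prod>j<d. l j) =
    (\<lambda>u. \<Sum>\<sigma> | \<sigma> permutes {..<d}. pure_tensor d (\<lambda>j. linear_coord (l (\<sigma> j))) u)"
proof (rule ext)
  fix u
  let ?c = "\<lambda>j. linear_coord (l j)"
  let ?G = "{..<d} \<rightarrow>\<^sub>E {..<n}"
  have "(\<Prod>j<d. l j) =
      (\<Prod>j<d. \<Sum>i<n. Poly_Mapping.single (Poly_Mapping.single i 1) (?c j i))"
    by (intro prod.cong[OF refl] linear_form_expand l) auto
  also have "\<dots> = (\<Sum>g\<in>?G. \<Prod>j<d. Poly_Mapping.single (Poly_Mapping.single (g j) 1) (?c j (g j)))"
    by (rule prod_sum_PiE) auto
  also have "\<dots> = (\<Sum>g\<in>?G. Poly_Mapping.single (\<Sum>j<d. Poly_Mapping.single (g j) 1) (\<Prod>j<d. ?c j (g j)))"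
    by (intro sum.cong[OF refl] prod_single) auto
  finally have "form_to_tensor d (\<Prod>j<d. l j) u = (\<Sum>g\<in>?G. (\<Prod>j<d. ?c j (g j)) *
      (\<Sum>\<sigma> | \<sigma> permutes {..<d}. pure_tensor d (\<lambda>j. basis_vec (g (\<sigma> j))) u))"
    by (simp only: form_to_tensor_sum form_to_tensor_monomial)
  also have "\<dots> = (\<Sum>\<sigma> | \<sigma> permutes {..<d}. \<Sum>g\<in>?G. (\<Prod>j<d. ?c j (g j)) *
      pure_tensor d (\<lambda>j. basis_vec (g (\<sigma> j))) u)"
    by (simp only: sum_distrib_left) (rule sum.swap)
  also have "\<dots> = (\<Sum>\<sigma> | \<sigma> permutes {..<d}. pure_tensor d (\<lambda>j. ?c (\<sigma> j)) u)"
  proof (intro sum.cong[OF refl])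
    fix \<sigma> assume "\<sigma> \<in> {\<sigma>. \<sigma> permutes {..<d}}"
    then have \<sigma>: "\<sigma> permutes {..<d}" by simp
    show "(\<Sum>g\<in>?G. (\<Prod>j<d. ?c j (g j)) * pure_tensor d (\<lambda>j. basis_vec (g (\<sigma> j))) u) =
        pure_tensor d (\<lambda>j. ?c (\<sigma> j)) u"
    proof (cases "length u = d")
      case True
      have coord: "?c k i = (\<Sum>i'<n. ?c k i' * basis_vec i' i)" if "k < d" for k i
      proof (cases "i < n")
        case True
        have "(\<Sum>i'<n. ?c k i' * basis_vec i' i) = (\<Sum>i'<n. if i' = i then ?c k i' else 0)"
          by (intro sum.cong) (auto simp: basis_vec_def)
        with True show ?thesis by simp
      next
        case False
        then have "Poly_Mapping.single i 1 \<notin> monomials n 1"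
          by (simp add: monomials_def)
        then have "?c k i = 0"
          using l[OF that] by (auto simp: forms_def in_keys_iff)
        moreover have "(\<Sum>i'<n. ?c k i' * basis_vec i' i) = 0"
          using False by (intro sum.neutral) (auto simp: basis_vec_def)
        ultimately show ?thesis by simp
      qed
      have reindex: "(\<Prod>j<d. h (\<sigma> j) j) = (\<Prod>k<d. h k (inv \<sigma> k))" for h :: "nat \<Rightarrow> nat \<Rightarrow> 'a"
        using prod.permute[OF \<sigma>, of "\<lambda>k. h k (inv \<sigma> k)"] permutes_inverses(2)[OF \<sigma>]
        by (simp add: o_def)
      have "(\<Prod>j<d. ?c (\<sigma> j) (u ! j)) = (\<Prod>k<d. ?c k (u ! inv \<sigma> k))"
        by (rule reindex)
      also have "\<dots> = (\<Prod>k<d. \<Sum>i<n. ?c k i * basis_vec i (u ! inv \<sigma> k))"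
        by (intro prod.cong[OF refl] coord) auto
      also have "\<dots> = (\<Sum>g\<in>?G. \<Prod>k<d. ?c k (g k) * basis_vec (g k) (u ! inv \<sigma> k))"
        by (rule prod_sum_PiE) auto
      also have "\<dots> = (\<Sum>g\<in>?G. (\<Prod>k<d. ?c k (g k)) * (\<Prod>j<d. basis_vec (g (\<sigma> j)) (u ! j)))"
        by (intro sum.cong[OF refl], subst reindex) (simp add: prod.distrib)
      finally show ?thesis
        using True by (simp add: pure_tensor_def)
    qed (simp add: pure_tensor_def)
  qed
  finally show "form_to_tensor d (\<Prod>j<d. l j) u =
      (\<Sum>\<sigma> | \<sigma> permutes {..<d}. pure_tensor d (\<lambda>j. ?c (\<sigma> j)) u)" .
qed

lemma length_mono_word: "length (mono_word m) = mdegree m"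
  by (simp add: mono_word_def mdegree_def length_concat o_def sum_list_distinct_conv_sum_set)

lemma form_to_tensor_inj:
  "inj_on (form_to_tensor d :: (nat, 'a::field_char_0) mpoly \<Rightarrow> 'a tensor) (forms n d)"
proof -
  have key: "\<exists>c. c \<noteq> 0 \<and> (\<forall>f \<in> forms n d.
      form_to_tensor d (f :: (nat, 'a) mpoly) (mono_word m) = Poly_Mapping.lookup f m * c)"
    if m: "m \<in> monomials n d" for m
  proof -
    define T where "T m' = (\<Sum>\<sigma> | \<sigma> permutes {..<d}.
        pure_tensor d (\<lambda>j. basis_vec (mono_word m' ! \<sigma> j)) (mono_word m) :: 'a)" for m'
    have len: "length (mono_word m') = d" if "m' \<in> monomials n d" for m'
      using that by (simp add: length_mono_word monomials_def)
    have T: "T m' = of_nat (card {\<sigma>. \<sigma> permutes {..<d} \<and> permute_list \<sigma> (mono_word m') = mono_word m})"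
      if m': "m' \<in> monomials n d" for m'
    proof -
      have "pure_tensor d (\<lambda>j. basis_vec (mono_word m' ! \<sigma> j)) (mono_word m) =
          (if permute_list \<sigma> (mono_word m') = mono_word m then 1 else 0 :: 'a)"
        if "\<sigma> permutes {..<d}" for \<sigma>
      proof (cases "\<forall>j<d. mono_word m ! j = mono_word m' ! \<sigma> j")
        case True
        then have "permute_list \<sigma> (mono_word m') = mono_word m"
          using that len[OF m] len[OF m'] by (intro nth_equalityI) (auto simp: permute_list_nth)
        with True show ?thesis
          by (simp add: pure_tensor_def basis_vec_def len[OF m])
      next
        case False
        then have "permute_list \<sigma> (mono_word m') \<noteq> mono_word m"
          using that len[OF m'] permute_list_nth[of \<sigma> "mono_word m'"] by metis
        with False show ?thesis
          by (auto simp: pure_tensor_def basis_vec_def len[OF m] intro!: prod_zero)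
      qed
      then have "T m' = (\<Sum>\<sigma> | \<sigma> permutes {..<d}.
          if permute_list \<sigma> (mono_word m') = mono_word m then 1 else 0)"
        unfolding T_def by (intro sum.cong) auto
      also have "\<dots> = (\<Sum>\<sigma> | \<sigma> permutes {..<d} \<and> permute_list \<sigma> (mono_word m') = mono_word m. 1)"
        by (intro sum.mono_neutral_cong_right) (auto simp: finite_permutations)
      finally show ?thesis by simp
    qed
    have "T m \<noteq> 0"
    proof -
      have "id \<in> {\<sigma>. \<sigma> permutes {..<d} \<and> permute_list \<sigma> (mono_word m) = mono_word m}"
        by (simp add: permutes_id)
      moreover have "finite {\<sigma>. \<sigma> permutes {..<d} \<and> permute_list \<sigma> (mono_word m) = mono_word m}"
        by (rule finite_subset[OF _ finite_permutations[of "{..<d}"]]) auto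
      ultimately show ?thesis
        unfolding T[OF m] by (metis (no_types, lifting) card_eq_0_iff empty_iff of_nat_eq_0_iff)
    qed
    moreover have "T m' = 0" if m': "m' \<in> monomials n d" "m' \<noteq> m" for m'
    proof -
      have "permute_list \<sigma> (mono_word m') \<noteq> mono_word m" if "\<sigma> permutes {..<d}" for \<sigma>
      proof
        assume "permute_list \<sigma> (mono_word m') = mono_word m"
        then have "mset (mono_word m') = mset (mono_word m)"
          using that len[OF m'(1)] mset_permute_list[of \<sigma> "mono_word m'"] by simp
        then have "m' = m"
          by (intro poly_mapping_eqI) (metis count_mono_word)
        with m'(2) show False ..
      qed
      then have "{\<sigma>. \<sigma> permutes {..<d} \<and> permute_list \<sigma> (mono_word m') = mono_word m} = {}"
        by blast
      then show ?thesis
        by (simp only: T[OF m'(1)] card.empty of_nat_0)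
    qed
    then have "form_to_tensor d f (mono_word m) = Poly_Mapping.lookup f m * T m"
      if "f \<in> forms n d" for f
    proof -
      have "form_to_tensor d f (mono_word m) =
          (\<Sum>m'\<in>insert m (Poly_Mapping.keys f). Poly_Mapping.lookup f m' * T m')"
        unfolding T_def by (rule form_to_tensor_superset) auto
      also have "\<dots> = (\<Sum>m'\<in>{m}. Poly_Mapping.lookup f m' * T m')"
        using that \<open>\<And>m'. m' \<in> monomials n d \<Longrightarrow> m' \<noteq> m \<Longrightarrow> T m' = 0\<close>
        by (intro sum.mono_neutral_right) (auto simp: forms_def)
      finally show ?thesis by simp
    qed
    ultimately show ?thesis by blast
  qed
  show ?thesis
  proof (rule inj_onI)
    fix f g :: "(nat, 'a) mpoly"
    assume f: "f \<in> forms n d" and g: "g \<in> forms n d" and eq: "form_to_tensor d f = form_to_tensor d g"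
    show "f = g"
    proof (rule poly_mapping_eqI)
      fix m
      show "Poly_Mapping.lookup f m = Poly_Mapping.lookup g m"
      proof (cases "m \<in> monomials n d")
        case True
        then show ?thesis
          using key[OF True] f g eq by (metis mult_right_cancel)
      next
        case False
        then show ?thesis
          using f g by (metis (no_types, lifting) forms_def in_keys_iff mem_Collect_eq subsetD)
      qed
    qed
  qed
qed

lemma form_to_tensor_prod_Var:
  "form_to_tensor n (\<Prod>i<n. Var i) = (perm_tensor n :: 'a::comm_ring_1 tensor)"
proof -
  have "(Var i :: (nat, 'a) mpoly) \<in> forms n 1" if "i < n" for i
    using that by (auto simp: Var_def forms_def monomials_def mdegree_def)
  moreover have "linear_coord (Var i) = (basis_vec i :: nat \<Rightarrow> 'a)" for i
    by (auto simp: fun_eq_iff Var_def lookup_single when_def basis_vec_def single_Suc_0_eq_iff)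
  ultimately show ?thesis
    by (subst form_to_tensor_prod[where n = n]) (simp_all add: perm_tensor_def)
qed

end

theory Submission
  imports Defs "Jordan_Normal_Form.Char_Poly"
begin

text \<open>
  The upper bound is the classical identity that writes \<open>x\<^sub>0 \<cdots> x\<^sub>m\<close>, up to a scalar, as the signed sum
  of the powers \<open>(x\<^sub>0 \<plusminus> x\<^sub>1 \<plusminus> \<dots> \<plusminus> x\<^sub>m)\<^sup>n\<close>, where \<open>n = m + 1\<close>; it has \<open>2\<^sup>m\<close> terms.

  The lower bound uses a flattening: a square matrix that depends linearly on a form \<open>g\<close> of degree \<open>n\<close>,
  is invertible at \<open>g = x\<^sub>0 \<cdots> x\<^sub>m\<close>, and whose rank at every power \<open>\<ell>\<^sup>n\<close> is at most its size divided
  by \<open>2\<^sup>m\<close>. Its determinant is a polynomial in the coefficients of \<open>g\<close>. It vanishes at every form of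
  Waring rank below \<open>2\<^sup>m\<close>, hence on the Zariski closure of the set of these forms, but not at the monomial.

  The matrix comes from a graded module over the even part of the polynomial ring in \<open>x\<^sub>0, \<dots>, x\<^sub>m\<close>. Let
  \<open>x\<^sub>i\<close> act on polynomials in \<open>t\<^sub>0, \<dots>, t\<^sub>m\<^sub>-\<^sub>1\<close> as multiplication by \<open>(t\<^sub>0 - i) \<cdots> (t\<^sub>m\<^sub>-\<^sub>1 - i)\<close>, and let
  \<open>M\<^sub>k\<close> consist of the polynomials of degree at most \<open>2 j + 1 + 2 k\<close> in each \<open>t\<^sub>j\<close>. A product of two of the \<open>x\<^sub>i\<close>
  maps \<open>M\<^sub>k\<close> into \<open>M\<^sub>k\<^sub>+\<^sub>1\<close>. (Geometrically, the product of \<open>m\<close> projective lines covers projective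
  \<open>m\<close>-space, by multiplication of binary linear forms, and the \<open>M\<^sub>k\<close> are the sections of the twists
  of a line bundle whose direct image is an Ulrich bundle for quadrics.) The crucial fact is that the sum of
  the \<open>M\<^sub>k\<close> is free over the ring generated by the squares \<open>x\<^sub>i\<^sup>2\<close>, on a basis of \<open>M\<^sub>0\<close>: interpolation at
  double points gives generation in degree \<open>0\<close> (\<open>generated_by_squares\<close>), and then a dimension count gives
  freeness (\<open>gens_basis\<close>).

  For a set \<open>S\<close> of even size let \<open>x\<^sub>S\<close> be the product of the \<open>x\<^sub>i\<close> with \<open>i \<in> S\<close>. Expanding \<open>x\<^sub>S b\<close> in the basis,
  for \<open>b\<close> in the basis of \<open>M\<^sub>0\<close>, and replacing \<open>x\<^sub>i\<^sup>2\<close> by \<open>c\<^sub>i\<^sup>2\<close> yields a matrix \<open>X\<^sub>S(c)\<close> whose entries are forms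
  of degree \<open>|S|\<close> in \<open>c\<close> and involve only even powers. Freeness turns \<open>x\<^sub>S x\<^sub>T = x\<^sub>S\<^sub>\<inter>\<^sub>T\<^sup>2 x\<^sub>S\<^sub>\<triangle>\<^sub>T\<close> into the rule
  \<open>X\<^sub>S(c) X\<^sub>T(c) = c\<^sub>S\<^sub>\<inter>\<^sub>T\<^sup>2 X\<^sub>S\<^sub>\<triangle>\<^sub>T(c)\<close> (\<open>struct_entry_mult\<close>). Put \<open>P(c) = \<Sum>\<^sub>S c\<^sub>S\<^sub>' X\<^sub>S(c)\<close>, where \<open>S'\<close> is the complement
  of \<open>S\<close>. This is homogeneous of degree \<open>n\<close> in \<open>c\<close>, and the coefficient of \<open>c\<^sub>0 \<cdots> c\<^sub>m\<close> in it is the identity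
  matrix, because only \<open>S = {}\<close> contributes a squarefree monomial. Moreover \<open>P(c)\<^sup>2 = 2\<^sup>m c\<^sub>0 \<cdots> c\<^sub>m P(c)\<close>, and
  \<open>P(c) P(\<epsilon> c) = 0\<close> for every nonconstant vector \<open>\<epsilon>\<close> of signs (\<open>twisted_entry_mult\<close>). So if no \<open>c\<^sub>i\<close> is \<open>0\<close>, the
  \<open>2\<^sup>m\<close> matrices \<open>P(\<epsilon> c)\<close> with \<open>\<epsilon>\<^sub>0 = 1\<close> are, up to scalars, orthogonal idempotents, and the block diagonal matrix
  formed from them factors through the space of a single block. The flattening at the power of \<open>\<Sum>\<^sub>i c\<^sub>i x\<^sub>i\<close> is this
  block diagonal matrix; that it is singular at short sums of powers follows for \<open>c\<close> with zero entries by perturbation.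
\<close>

section \<open>Polynomials of bounded degree in each variable\<close>

lemma Const_simps [simp]:
  "Const 0 = (0 :: ('v, 'a::comm_ring_1) mpoly)"
  "Const 1 = (1 :: ('v, 'a::comm_ring_1) mpoly)"
  by (simp_all add: Const_def)

lemma Const_add: "Const (a + b) = Const a + (Const b :: ('v, 'a::comm_ring_1) mpoly)"
  by (simp add: Const_def single_add)

lemma Const_mult: "Const (a * b) = Const a * (Const b :: ('v, 'a::comm_ring_1) mpoly)"
  by (simp add: Const_def mult_single)

interpretation Const_hom: comm_ring_hom "Const :: 'a::comm_ring_1 \<Rightarrow> ('v, 'a) mpoly"
  by unfold_locales (auto simp: Const_add Const_mult)

interpretation mpoly: vector_space "\<lambda>(c::'a::field) (p::('v, 'a) mpoly). Const c * p"
  by unfold_locales (auto simp: Const_add Const_mult algebra_simps)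

lemma Const_mult_single: "Const c * Poly_Mapping.single m d = Poly_Mapping.single m (c * d)"
  by (simp add: Const_def mult_single)

lemma poly_mapping_expand: "p = (\<Sum>k\<in>Poly_Mapping.keys p. Poly_Mapping.single k (Poly_Mapping.lookup p k))"
  by (rule poly_mapping_eqI) (auto simp: lookup_sum lookup_single when_def in_keys_iff)

lemma lookup_Const_mult: "Poly_Mapping.lookup (Const c * p) m = c * Poly_Mapping.lookup p m"
proof -
  have "Const c * p = (\<Sum>k\<in>Poly_Mapping.keys p. Const c * Poly_Mapping.single k (Poly_Mapping.lookup p k))"
    by (subst poly_mapping_expand[of p]) (simp add: sum_distrib_left)
  also have "\<dots> = (\<Sum>k\<in>Poly_Mapping.keys p. Poly_Mapping.single k (c * Poly_Mapping.lookup p k))"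
    by (simp add: Const_mult_single)
  finally show ?thesis
    by (auto simp: lookup_sum lookup_single when_def in_keys_iff)
qed

lemma Var_power: "Var i ^ k = Poly_Mapping.single (Poly_Mapping.single i k) (1::'a::comm_ring_1)"
  by (induction k) (simp_all add: Var_def mult_single flip: single_add)

definition bounded_polys :: "('v \<Rightarrow> nat) \<Rightarrow> ('v, 'a::comm_ring_1) mpoly set" where
  "bounded_polys d = {p. \<forall>m\<in>Poly_Mapping.keys p. \<forall>v. Poly_Mapping.lookup m v \<le> d v}"

lemma bounded_polys_zero [simp]: "0 \<in> bounded_polys d"
  by (simp add: bounded_polys_def)

lemma bounded_polys_add:
  "p \<in> bounded_polys d \<Longrightarrow> q \<in> bounded_polys d \<Longrightarrow> p + q \<in> bounded_polys d"
  using keys_add[of p q] by (auto simp: bounded_polys_def)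

lemma bounded_polys_diff:
  "p \<in> bounded_polys d \<Longrightarrow> q \<in> bounded_polys d \<Longrightarrow> p - q \<in> bounded_polys d"
  using keys_diff[of p q] by (auto simp: bounded_polys_def)

lemma bounded_polys_sum:
  "(\<And>i. i \<in> A \<Longrightarrow> f i \<in> bounded_polys d) \<Longrightarrow> sum f A \<in> bounded_polys d"
  by (induction A rule: infinite_finite_induct) (auto intro: bounded_polys_add)

lemma bounded_polys_mult:
  assumes "p \<in> bounded_polys d" "q \<in> bounded_polys e"
  shows "p * q \<in> bounded_polys (\<lambda>v. d v + e v)"
  using keys_mult[of p q] assms by (fastforce simp: bounded_polys_def lookup_add intro: add_mono)

lemma bounded_polys_mono:
  "p \<in> bounded_polys d \<Longrightarrow> (\<And>v. d v \<le> e v) \<Longrightarrow> p \<in> bounded_polys e"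
  by (fastforce simp: bounded_polys_def intro: order_trans)

lemma bounded_polys_Const [simp]: "Const c \<in> bounded_polys d"
  by (simp add: bounded_polys_def Const_def)

lemma bounded_polys_one [simp]: "1 \<in> bounded_polys d"
  using bounded_polys_Const[of 1 d] by simp

lemma bounded_polys_single:
  "(\<And>v. Poly_Mapping.lookup m v \<le> d v) \<Longrightarrow> Poly_Mapping.single m c \<in> bounded_polys d"
  by (simp add: bounded_polys_def)

lemma bounded_polys_Var: "1 \<le> d i \<Longrightarrow> Var i \<in> bounded_polys d"
  unfolding Var_def by (rule bounded_polys_single) (auto simp: lookup_single when_def)

lemma bounded_polys_prod:
  "(\<And>i. i \<in> A \<Longrightarrow> f i \<in> bounded_polys (d i)) \<Longrightarrow>
     prod f A \<in> bounded_polys (\<lambda>v. \<Sum>i\<in>A. d i v)"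
  by (induction A rule: infinite_finite_induct) (auto dest: bounded_polys_mult)

lemma bounded_polys_power:
  "p \<in> bounded_polys d \<Longrightarrow> p ^ k \<in> bounded_polys (\<lambda>v. k * d v)"
  using bounded_polys_prod[of "{..<k}" "\<lambda>_. p" "\<lambda>_. d"] by simp

section \<open>One variable: interpolation with double points\<close>

text \<open>
  One step of the interpolation: a multiple of \<open>q\<close> adjusts the value at \<open>w\<close>, and the remaining factor
  \<open>t - w\<close> lowers the degree by one.
\<close>

lemma subtract_multiple_at_point:
  fixes p q :: "'a::field poly"
  assumes "poly q w \<noteq> 0" "degree p \<le> Suc D" "degree q \<le> Suc D"
  obtains c s where "p = Polynomial.smult c q + [:-w, 1:] * s" "degree s \<le> D"
proof -
  let ?c = "poly p w / poly q w"
  have "poly (p - Polynomial.smult ?c q) w = 0"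
    using assms(1) by simp
  then obtain s where s: "p - Polynomial.smult ?c q = [:-w, 1:] * s"
    by (metis poly_eq_0_iff_dvd dvdE)
  have "degree s \<le> D"
  proof (cases "s = 0")
    case False
    then have "degree ([:-w, 1:] * s) = Suc (degree s)"
      by (subst degree_mult_eq) auto
    moreover have "degree (p - Polynomial.smult ?c q) \<le> Suc D"
      by (rule degree_diff_le) (use assms in \<open>auto intro: order_trans[OF degree_smult_le]\<close>)
    ultimately show ?thesis
      using s by simp
  qed simp
  moreover from s have "p = Polynomial.smult ?c q + [:-w, 1:] * s"
    by (simp add: algebra_simps)
  ultimately show thesis
    using that by blast
qed

text \<open>
  A polynomial in one variable whose degree is small compared with the number of double points is a
  combination of the products that omit one double point. For \<open>k = 1\<close> this is Hermite interpolation; both the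
  number of points and the bound \<open>2 k\<close> on the coefficients are what the degrees \<open>2 j + 1 + 2 k\<close> of \<open>deg_bound\<close> require.
\<close>

lemma double_point_interpolation:
  fixes p :: "'a::field poly" and a :: "'i \<Rightarrow> 'a"
  assumes "finite U" "U \<noteq> {}" "inj_on a U" "0 < k" "degree p < 2 * (card U - 1) + 2 * k"
  shows "\<exists>r. (\<forall>u\<in>U. degree (r u) < 2 * k) \<and>
           p = (\<Sum>u\<in>U. r u * (\<Prod>v\<in>U - {u}. [:-a v, 1:] ^ 2))"
  using assms
proof (induction U arbitrary: p rule: finite_ne_induct)
  case (singleton u)
  then show ?case
    by (intro exI[of _ "\<lambda>_. p"]) auto
next
  case (insert w F)
  define L where "L = [:-a w, 1:]"
  define q where "q = (\<Prod>v\<in>F. [:-a v, 1:] ^ 2)"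
  have "card F > 0"
    using insert by (simp add: card_gt_0_iff)
  have dq: "degree q = 2 * card F"
    unfolding q_def by (subst degree_prod_eq_sum_degree) (auto simp: degree_power_eq)
  have "poly q (a w) \<noteq> 0"
    using insert by (auto simp: q_def poly_prod)
  \<comment> \<open>The new point is double, so the step above is carried out twice at it; what remains is handled by induction.\<close>
  have bounds: "degree p \<le> Suc (2 * card F + 2 * k - 2)" "degree q \<le> Suc (2 * card F + 2 * k - 2)"
    using insert dq by auto
  obtain c s where s: "p = Polynomial.smult c q + L * s" "degree s \<le> 2 * card F + 2 * k - 2"
    unfolding L_def by (rule subtract_multiple_at_point[OF \<open>poly q (a w) \<noteq> 0\<close> bounds])
  have bounds': "degree s \<le> Suc (2 * card F + 2 * k - 3)" "degree q \<le> Suc (2 * card F + 2 * k - 3)"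
    using s insert.prems dq \<open>card F > 0\<close> by auto
  obtain c' s' where s': "s = Polynomial.smult c' q + L * s'" "degree s' \<le> 2 * card F + 2 * k - 3"
    unfolding L_def by (rule subtract_multiple_at_point[OF \<open>poly q (a w) \<noteq> 0\<close> bounds'])
  have "degree s' < 2 * (card F - 1) + 2 * k"
    using s' insert.prems \<open>card F > 0\<close> by linarith
  then obtain r where r: "\<forall>u\<in>F. degree (r u) < 2 * k"
      "s' = (\<Sum>u\<in>F. r u * (\<Prod>v\<in>F - {u}. [:-a v, 1:] ^ 2))"
    using insert.IH[of s'] insert.prems by auto
  let ?r = "r(w := [:c:] + Polynomial.smult c' L)"
  have "p = ([:c:] + Polynomial.smult c' L) * q + L ^ 2 * s'"
    unfolding s(1) s'(1) by (simp add: algebra_simps power2_eq_square)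
  also have "q = (\<Prod>v\<in>insert w F - {w}. [:-a v, 1:] ^ 2)"
    using insert by (simp add: q_def)
  also have "L ^ 2 * s' = (\<Sum>u\<in>F. r u * (L ^ 2 * (\<Prod>v\<in>F - {u}. [:-a v, 1:] ^ 2)))"
    unfolding r(2) sum_distrib_left by (intro sum.cong) (auto simp: algebra_simps)
  also have "\<dots> = (\<Sum>u\<in>F. ?r u * (\<Prod>v\<in>insert w F - {u}. [:-a v, 1:] ^ 2))"
  proof (intro sum.cong refl)
    fix u assume "u \<in> F"
    then have "insert w F - {u} = insert w (F - {u})" "u \<noteq> w"
      using insert by auto
    then show "r u * (L\<^sup>2 * (\<Prod>v\<in>F - {u}. [:- a v, 1:]\<^sup>2)) =
        ?r u * (\<Prod>v\<in>insert w F - {u}. [:- a v, 1:]\<^sup>2)"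
      using insert by (simp add: L_def)
  qed
  finally have "p = (\<Sum>u\<in>insert w F. ?r u * (\<Prod>v\<in>insert w F - {u}. [:- a v, 1:]\<^sup>2))"
    using insert by simp
  moreover have "degree (?r u) < 2 * k" if "u \<in> insert w F" for u
  proof (cases "u = w")
    case True
    have "degree ([:c:] + Polynomial.smult c' L) \<le> 1"
      by (auto simp: L_def)
    with True insert.prems show ?thesis
      by simp
  next
    case False
    with that r show ?thesis by simp
  qed
  ultimately show ?case
    by (intro exI[of _ ?r]) blast
qed

abbreviation subst_poly :: "('v, 'a::comm_ring_1) mpoly \<Rightarrow> 'a poly \<Rightarrow> ('v, 'a) mpoly" where
  "subst_poly x p \<equiv> poly (map_poly Const p) x"

interpretation Const_poly_hom: map_poly_comm_ring_hom "Const :: 'a::comm_ring_1 \<Rightarrow> ('v, 'a) mpoly"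
  by unfold_locales

lemma bounded_polys_subst_poly:
  assumes "degree p \<le> d j"
  shows "subst_poly (Var j) p \<in> bounded_polys (d :: 'v \<Rightarrow> nat)"
proof -
  have "subst_poly (Var j) p =
      (\<Sum>i\<le>degree (map_poly Const p :: ('v, 'a) mpoly poly). Const (coeff p i) * Var j ^ i)"
    by (simp add: poly_altdef coeff_map_poly)
  moreover have "Const (coeff p i) * Var j ^ i \<in> bounded_polys d"
    if "i \<le> degree (map_poly Const p :: ('v, 'a) mpoly poly)" for i
  proof -
    have "i \<le> d j"
      using that degree_map_poly_le[of "Const :: _ \<Rightarrow> ('v, 'a) mpoly" p] assms by linarith
    then show ?thesis
      unfolding Var_power Const_mult_single
      by (intro bounded_polys_single) (auto simp: lookup_single when_def)
  qed
  ultimately show ?thesis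
    by (auto intro: bounded_polys_sum)
qed

section \<open>Generation in lowest degree\<close>

text \<open>
  The bounds grow by two from one variable to the next. This makes the induction on the number of variables in
  \<open>generated_by_squares\<close> work and makes the dimensions of the graded pieces those of a free module.
\<close>

definition deg_bound :: "nat \<Rightarrow> nat \<Rightarrow> nat \<Rightarrow> nat" where
  "deg_bound m k = (\<lambda>j. if j < m then 2 * j + 1 + 2 * k else 0)"

text \<open>
  The polynomial by which the variable \<open>x\<^sub>i\<close> acts, for \<open>a = i\<close>. It is the value at \<open>a\<close>, up to sign, of the
  polynomial with roots \<open>t\<^sub>0, \<dots>, t\<^sub>m\<^sub>-\<^sub>1\<close>.
\<close>

definition root_prod :: "nat \<Rightarrow> 'a \<Rightarrow> (nat, 'a::comm_ring_1) mpoly" where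
  "root_prod m a = (\<Prod>j<m. Var j - Const a)"

lemma root_prod_Suc: "root_prod (Suc m) a = root_prod m a * (Var m - Const a)"
  by (simp add: root_prod_def)

lemma bounded_polys_root_prod: "root_prod m a \<in> bounded_polys (\<lambda>j. if j < m then 1 else 0)"
proof -
  have "root_prod m a \<in> bounded_polys (\<lambda>v. \<Sum>j<m. if v = j then 1 else 0)"
    unfolding root_prod_def
    by (intro bounded_polys_prod bounded_polys_diff bounded_polys_Var bounded_polys_Const) simp
  then show ?thesis
    by (rule bounded_polys_mono) simp
qed

text \<open>
  The module is generated in lowest degree by the squares at any \<open>m + 1\<close> distinct points. The induction is on \<open>m\<close>:
  in the last variable, interpolation writes a power as a combination of products over all double points but one, say \<open>u\<close>.
  For each \<open>u\<close> the induction hypothesis applies to the remaining points \<open>I - {u}\<close>, and every square of the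
  first \<open>m\<close> variables that it produces finds its missing factor \<open>(t\<^sub>m - a\<^sub>i)\<^sup>2\<close> in the product over \<open>I - {u}\<close>.
\<close>

lemma generated_by_squares:
  fixes a :: "nat \<Rightarrow> 'a::field"
  assumes "finite I" "card I = Suc m" "inj_on a I" "p \<in> bounded_polys (deg_bound m (Suc k))"
  shows "\<exists>q. (\<forall>i\<in>I. q i \<in> bounded_polys (deg_bound m k)) \<and>
           p = (\<Sum>i\<in>I. root_prod m (a i) ^ 2 * q i)"
  using assms
proof (induction m arbitrary: I p)
  case 0
  then obtain i where I: "I = {i}"
    by (metis One_nat_def card_1_singletonE)
  from 0 have "p \<in> bounded_polys (deg_bound 0 k)"
    by (simp add: deg_bound_def)
  then show ?case
    by (intro exI[of _ "\<lambda>_. p"]) (simp add: I root_prod_def)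
next
  case (Suc m)
  \<comment> \<open>By linearity it suffices to treat a single monomial, split into its last variable and the rest.\<close>
  have mono: "\<exists>q. (\<forall>i\<in>I. q i \<in> bounded_polys (deg_bound (Suc m) k)) \<and>
      Poly_Mapping.single \<mu> c = (\<Sum>i\<in>I. root_prod (Suc m) (a i) ^ 2 * q i)"
    if \<mu>: "\<And>v. Poly_Mapping.lookup \<mu> v \<le> deg_bound (Suc m) (Suc k) v" for \<mu> and c :: 'a
  proof -
    define d where "d = Poly_Mapping.lookup \<mu> m"
    define \<mu>' where "\<mu>' = \<mu> - Poly_Mapping.single m d"
    have lookup_\<mu>': "Poly_Mapping.lookup \<mu>' v = (if v = m then 0 else Poly_Mapping.lookup \<mu> v)" for v
      by (auto simp: \<mu>'_def d_def lookup_minus lookup_single when_def)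
    have "\<mu> = \<mu>' + Poly_Mapping.single m d"
      by (rule poly_mapping_eqI) (auto simp: lookup_add lookup_\<mu>' lookup_single when_def d_def)
    then have split: "Poly_Mapping.single \<mu> c = Poly_Mapping.single \<mu>' c * Var m ^ d"
      by (simp add: Var_power mult_single)
    have base: "Poly_Mapping.single \<mu>' c \<in> bounded_polys (deg_bound m (Suc k))"
    proof (rule bounded_polys_single)
      show "Poly_Mapping.lookup \<mu>' v \<le> deg_bound m (Suc k) v" for v
        using \<mu>[of v] by (auto simp: lookup_\<mu>' deg_bound_def split: if_splits)
    qed
    have "\<forall>u\<in>I. \<exists>q. (\<forall>i\<in>I - {u}. q i \<in> bounded_polys (deg_bound m k)) \<and>
        Poly_Mapping.single \<mu>' c = (\<Sum>i\<in>I - {u}. root_prod m (a i) ^ 2 * q i)"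
    proof
      fix u assume u: "u \<in> I"
      show "\<exists>q. (\<forall>i\<in>I - {u}. q i \<in> bounded_polys (deg_bound m k)) \<and>
        Poly_Mapping.single \<mu>' c = (\<Sum>i\<in>I - {u}. root_prod m (a i) ^ 2 * q i)"
      proof (rule Suc.IH[OF _ _ _ base])
        show "finite (I - {u})" "card (I - {u}) = Suc m"
          using Suc.prems(1,2) u by simp_all
        show "inj_on a (I - {u})"
          using Suc.prems(3) by (rule inj_on_subset) blast
      qed
    qed
    from bchoice[OF this] obtain q where
      q': "\<forall>u\<in>I. (\<forall>i\<in>I - {u}. q u i \<in> bounded_polys (deg_bound m k)) \<and>
        Poly_Mapping.single \<mu>' c = (\<Sum>i\<in>I - {u}. root_prod m (a i) ^ 2 * q u i)" ..
    have q: "q u i \<in> bounded_polys (deg_bound m k)" if "u \<in> I" "i \<in> I - {u}" for u i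
      using q' that by simp
    have q_eq: "Poly_Mapping.single \<mu>' c = (\<Sum>i\<in>I - {u}. root_prod m (a i) ^ 2 * q u i)" if "u \<in> I" for u
      using q' that by simp
    have "d \<le> 2 * m + 3 + 2 * k"
      using \<mu>[of m] by (simp add: d_def deg_bound_def)
    then have "degree (monom (1::'a) d) < 2 * (card I - 1) + 2 * Suc k"
      using Suc.prems by (simp add: degree_monom_eq)
    moreover have "I \<noteq> {}"
      using Suc.prems by auto
    ultimately obtain r where r: "\<forall>u\<in>I. degree (r u) < 2 * Suc k"
      "monom 1 d = (\<Sum>u\<in>I. r u * (\<Prod>v\<in>I - {u}. [:-a v, 1:] ^ 2))"
      using double_point_interpolation[OF Suc.prems(1) _ Suc.prems(3), of "Suc k" "monom 1 d"] by auto
    define x where "x = (Var m :: (nat, 'a) mpoly)"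
    define R where "R u = subst_poly x (r u)" for u
    have lin: "subst_poly x [:-a v, 1:] = x - Const (a v)" for v
      by (simp add: Const_hom.hom_uminus)
    have "x ^ d = subst_poly x (monom 1 d)"
      by (simp add: map_poly_monom poly_monom)
    also have "\<dots> = (\<Sum>u\<in>I. R u * (\<Prod>v\<in>I - {u}. (x - Const (a v)) ^ 2))"
      unfolding r(2) R_def lin[symmetric]
      by (simp add: Const_poly_hom.hom_sum Const_poly_hom.hom_prod Const_poly_hom.hom_mult
          Const_poly_hom.hom_power poly_sum poly_prod)
    finally have xd: "x ^ d = (\<Sum>u\<in>I. R u * (\<Prod>v\<in>I - {u}. (x - Const (a v)) ^ 2))" .
    define Q where "Q i = (\<Sum>u\<in>I - {i}. q u i * (R u * (\<Prod>v\<in>I - {u} - {i}. (x - Const (a v)) ^ 2)))" for i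
    have "Poly_Mapping.single \<mu> c = (\<Sum>u\<in>I. R u * (\<Prod>v\<in>I - {u}. (x - Const (a v)) ^ 2) * Poly_Mapping.single \<mu>' c)"
      unfolding split x_def[symmetric] xd by (simp add: sum_distrib_left mult_ac)
    also have "\<dots> = (\<Sum>u\<in>I. \<Sum>i\<in>I - {u}. root_prod (Suc m) (a i) ^ 2 *
        (q u i * (R u * (\<Prod>v\<in>I - {u} - {i}. (x - Const (a v)) ^ 2))))"
    proof (rule sum.cong[OF refl])
      fix u assume u: "u \<in> I"
      \<comment> \<open>The factor for the point \<open>i\<close> is taken out of the product and completes the square of \<open>root_prod\<close>.\<close>
      have "R u * (\<Prod>v\<in>I - {u}. (x - Const (a v)) ^ 2) * (root_prod m (a i) ^ 2 * q u i) =
          root_prod (Suc m) (a i) ^ 2 * (q u i * (R u * (\<Prod>v\<in>I - {u} - {i}. (x - Const (a v)) ^ 2)))"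
        if "i \<in> I - {u}" for i
      proof -
        have "(\<Prod>v\<in>I - {u}. (x - Const (a v)) ^ 2) =
            (x - Const (a i)) ^ 2 * (\<Prod>v\<in>I - {u} - {i}. (x - Const (a v)) ^ 2)"
          using that Suc.prems(1) by (intro prod.remove) auto
        then show ?thesis
          by (simp add: root_prod_Suc x_def power_mult_distrib mult_ac)
      qed
      then show "R u * (\<Prod>v\<in>I - {u}. (x - Const (a v)) ^ 2) * Poly_Mapping.single \<mu>' c =
          (\<Sum>i\<in>I - {u}. root_prod (Suc m) (a i) ^ 2 *
            (q u i * (R u * (\<Prod>v\<in>I - {u} - {i}. (x - Const (a v)) ^ 2))))"
        unfolding q_eq[OF u] sum_distrib_left by (intro sum.cong refl)
    qed
    also have "\<dots> = (\<Sum>i\<in>I. \<Sum>u\<in>I - {i}. root_prod (Suc m) (a i) ^ 2 *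
        (q u i * (R u * (\<Prod>v\<in>I - {u} - {i}. (x - Const (a v)) ^ 2))))"
    proof -
      have *: "(\<Sum>u\<in>I. \<Sum>i\<in>I - {u}. f u i) = (\<Sum>u\<in>I. \<Sum>i\<in>I. if i = u then 0 else f u i)"
        for f :: "nat \<Rightarrow> nat \<Rightarrow> (nat, 'a) mpoly"
        using Suc.prems(1) by (intro sum.cong refl sum.mono_neutral_cong_left) auto
      show ?thesis
        unfolding * by (subst sum.swap, intro sum.cong refl) auto
    qed
    also have "\<dots> = (\<Sum>i\<in>I. root_prod (Suc m) (a i) ^ 2 * Q i)"
      by (simp add: Q_def sum_distrib_left)
    finally have eq: "Poly_Mapping.single \<mu> c = (\<Sum>i\<in>I. root_prod (Suc m) (a i) ^ 2 * Q i)" .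
    have "Q i \<in> bounded_polys (deg_bound (Suc m) k)" if "i \<in> I" for i
      unfolding Q_def
    proof (rule bounded_polys_sum)
      fix u assume u: "u \<in> I - {i}"
      let ?e = "\<lambda>e j. if j = m then e else 0 :: nat"
      have 1: "q u i \<in> bounded_polys (deg_bound m k)"
        using u that by (intro q) auto
      have 2: "R u \<in> bounded_polys (?e (2 * k + 1))"
        unfolding R_def x_def using r(1) u by (intro bounded_polys_subst_poly) fastforce
      have "(x - Const (a v)) ^ 2 \<in> bounded_polys (\<lambda>j. 2 * ?e 1 j)" for v
        unfolding x_def
        by (intro bounded_polys_power bounded_polys_diff bounded_polys_Var bounded_polys_Const) simp
      then have "(\<Prod>v\<in>I - {u} - {i}. (x - Const (a v)) ^ 2) \<in> bounded_polys (\<lambda>j. \<Sum>v\<in>I - {u} - {i}. 2 * ?e 1 j)"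
        by (rule bounded_polys_prod)
      moreover have "card (I - {u} - {i}) = m"
        using Suc.prems u that by simp
      ultimately have 3: "(\<Prod>v\<in>I - {u} - {i}. (x - Const (a v)) ^ 2) \<in> bounded_polys (?e (2 * m))"
        by (auto elim: bounded_polys_mono)
      show "q u i * (R u * (\<Prod>v\<in>I - {u} - {i}. (x - Const (a v)) ^ 2)) \<in> bounded_polys (deg_bound (Suc m) k)"
        by (rule bounded_polys_mono[OF bounded_polys_mult[OF 1 bounded_polys_mult[OF 2 3]]])
          (auto simp: deg_bound_def)
    qed
    with eq show ?thesis
      by blast
  qed
  have "\<forall>\<mu>\<in>Poly_Mapping.keys p. \<exists>q. (\<forall>i\<in>I. q i \<in> bounded_polys (deg_bound (Suc m) k)) \<and>
      Poly_Mapping.single \<mu> (Poly_Mapping.lookup p \<mu>) = (\<Sum>i\<in>I. root_prod (Suc m) (a i) ^ 2 * q i)"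
    using Suc.prems(4) by (intro ballI mono) (auto simp: bounded_polys_def)
  from bchoice[OF this] obtain q where
    q: "\<forall>\<mu>\<in>Poly_Mapping.keys p. (\<forall>i\<in>I. q \<mu> i \<in> bounded_polys (deg_bound (Suc m) k)) \<and>
      Poly_Mapping.single \<mu> (Poly_Mapping.lookup p \<mu>) = (\<Sum>i\<in>I. root_prod (Suc m) (a i) ^ 2 * q \<mu> i)" ..
  have "p = (\<Sum>\<mu>\<in>Poly_Mapping.keys p. \<Sum>i\<in>I. root_prod (Suc m) (a i) ^ 2 * q \<mu> i)"
    using poly_mapping_expand[of p] q by simp
  also have "\<dots> = (\<Sum>i\<in>I. root_prod (Suc m) (a i) ^ 2 * (\<Sum>\<mu>\<in>Poly_Mapping.keys p. q \<mu> i))"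
    by (subst sum.swap) (simp add: sum_distrib_left)
  finally show ?case
    using q by (intro exI[of _ "\<lambda>i. \<Sum>\<mu>\<in>Poly_Mapping.keys p. q \<mu> i"]) (auto intro: bounded_polys_sum)
qed

section \<open>A basis in each degree\<close>

definition exponents :: "('v \<Rightarrow> nat) \<Rightarrow> ('v \<Rightarrow>\<^sub>0 nat) set" where
  "exponents d = {m. \<forall>v. Poly_Mapping.lookup m v \<le> d v}"


lemma finite_card_exponents:
  fixes d :: "nat \<Rightarrow> nat"
  assumes d: "\<And>j. j \<ge> m \<Longrightarrow> d j = 0"
  shows "finite (exponents d)" "card (exponents d) = (\<Prod>j<m. Suc (d j))"
proof -
  let ?f = "\<lambda>\<mu>. restrict (Poly_Mapping.lookup \<mu>) {..<m}"
  let ?g = "\<lambda>h. \<Sum>j<m. Poly_Mapping.single j (h j :: nat)"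
  let ?P = "\<Pi>\<^sub>E j\<in>{..<m}. {..d j}"
  have lookup_g: "Poly_Mapping.lookup (?g h) v = (if v < m then h v else 0)" for h v
    by (auto simp: lookup_sum lookup_single when_def)
  have "bij_betw ?f (exponents d) ?P"
  proof (rule bij_betw_byWitness[where f' = ?g])
    show "\<forall>\<mu>\<in>exponents d. ?g (?f \<mu>) = \<mu>"
    proof
      fix \<mu> assume "\<mu> \<in> exponents d"
      then have "Poly_Mapping.lookup \<mu> v = 0" if "v \<ge> m" for v
        using d[OF that] by (auto simp: exponents_def dest!: spec[of _ v])
      then show "?g (?f \<mu>) = \<mu>"
        by (intro poly_mapping_eqI) (auto simp: lookup_g)
    qed
    show "\<forall>h\<in>?P. ?f (?g h) = h"
      by (auto simp: lookup_g fun_eq_iff PiE_def extensional_def restrict_def)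
    show "?f ` exponents d \<subseteq> ?P"
      by (auto simp: exponents_def PiE_def extensional_def)
    show "?g ` ?P \<subseteq> exponents d"
    proof
      fix \<mu> assume "\<mu> \<in> ?g ` ?P"
      then obtain h where h: "\<mu> = ?g h" "h \<in> ?P"
        by (rule imageE)
      have "Poly_Mapping.lookup \<mu> v \<le> d v" for v
        using h(2) by (auto simp: h(1) lookup_g)
      then show "\<mu> \<in> exponents d"
        by (simp add: exponents_def)
    qed
  qed
  moreover have "finite ?P" "card ?P = (\<Prod>j<m. Suc (d j))"
    by (auto simp: card_PiE intro!: finite_PiE)
  ultimately show "finite (exponents d)" "card (exponents d) = (\<Prod>j<m. Suc (d j))"
    by (simp_all add: bij_betw_finite bij_betw_same_card)
qed

abbreviation power_prod :: "('v \<Rightarrow>\<^sub>0 nat) \<Rightarrow> ('v, 'a::comm_ring_1) mpoly" where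
  "power_prod \<mu> \<equiv> Poly_Mapping.single \<mu> 1"

lemma power_prod_eq_iff [simp]:
  "(power_prod \<mu> :: ('v, 'a::comm_ring_1) mpoly) = power_prod \<nu> \<longleftrightarrow> \<mu> = \<nu>"
  by (metis keys_single singleton_inject zero_neq_one)

lemma independent_monos:
  "mpoly.independent (power_prod ` M :: ('v, 'a::field) mpoly set)"
  unfolding mpoly.independent_explicit_finite_subsets
proof (intro allI impI ballI)
  fix S and u :: "('v, 'a) mpoly \<Rightarrow> 'a" and v
  assume S: "S \<subseteq> power_prod ` M" "finite S" "(\<Sum>v\<in>S. Const (u v) * v) = 0" "v \<in> S"
  then obtain \<mu> where \<mu>: "v = power_prod \<mu>"
    by auto
  have "0 = Poly_Mapping.lookup (\<Sum>v\<in>S. Const (u v) * v) \<mu>"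
    using S by simp
  also have "\<dots> = (\<Sum>w\<in>S. u w * Poly_Mapping.lookup w \<mu>)"
    by (simp add: lookup_sum lookup_Const_mult)
  also have "\<dots> = (\<Sum>w\<in>S. if w = v then u v else 0)"
  proof (rule sum.cong[OF refl])
    fix w assume "w \<in> S"
    then obtain \<nu> where "w = power_prod \<nu>"
      using S(1) by blast
    then show "u w * Poly_Mapping.lookup w \<mu> = (if w = v then u v else 0)"
      by (auto simp: \<mu> lookup_single when_def)
  qed
  also have "\<dots> = u v"
    using S by simp
  finally show "u v = 0" ..
qed

definition compositions :: "nat \<Rightarrow> nat \<Rightarrow> nat list set" where
  "compositions n k = {\<alpha>. length \<alpha> = n \<and> sum_list \<alpha> = k}"

lemma finite_compositions [simp]: "finite (compositions n k)"
proof (rule finite_subset)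
  show "compositions n k \<subseteq> {\<alpha>. set \<alpha> \<subseteq> {..k} \<and> length \<alpha> = n}"
    by (auto simp: compositions_def member_le_sum_list)
qed (simp add: finite_lists_length_eq)

lemma compositions_0: "compositions n 0 = {replicate n 0}"
proof
  show "compositions n 0 \<subseteq> {replicate n 0}"
    unfolding compositions_def sum_list_eq_0_iff by (auto intro: replicate_eqI)
qed (simp add: compositions_def sum_list_replicate)

text \<open>
  The monomial with exponents \<open>\<alpha>\<close> in the squares of the \<open>x\<^sub>i\<close>.
\<close>

definition square_prod :: "nat \<Rightarrow> nat list \<Rightarrow> (nat, 'a::comm_ring_1) mpoly" where
  "square_prod m \<alpha> = (\<Prod>i<Suc m. root_prod m (of_nat i) ^ (2 * \<alpha> ! i))"

lemma square_prod_add: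
  assumes "\<alpha> \<in> compositions (Suc m) k" "\<beta> \<in> compositions (Suc m) l"
  shows "map2 (+) \<alpha> \<beta> \<in> compositions (Suc m) (k + l)"
    "square_prod m (map2 (+) \<alpha> \<beta>) = square_prod m \<alpha> * square_prod m \<beta>"
proof -
  have "sum_list (map2 (+) \<alpha> \<beta>) = sum_list \<alpha> + sum_list \<beta>" if "length \<alpha> = length \<beta>" for \<alpha> \<beta> :: "nat list"
    using that by (induction \<alpha> \<beta> rule: list_induct2) auto
  then show "map2 (+) \<alpha> \<beta> \<in> compositions (Suc m) (k + l)"
    using assms by (simp add: compositions_def)
  show "square_prod m (map2 (+) \<alpha> \<beta>) = square_prod m \<alpha> * square_prod m \<beta>"
    unfolding square_prod_def prod.distrib[symmetric] using assms
    by (intro prod.cong refl) (auto simp: compositions_def power_add distrib_left)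
qed

definition indicator_list :: "nat \<Rightarrow> nat set \<Rightarrow> nat list" where
  "indicator_list n A = map (\<lambda>i. if i \<in> A then 1 else 0) [0..<n]"

lemma indicator_list_composition:
  assumes "A \<subseteq> {..<n}"
  shows "indicator_list n A \<in> compositions n (card A)"
proof -
  have "sum_list (indicator_list n A) = (\<Sum>i<n. if i \<in> A then 1 else 0)"
    by (simp add: indicator_list_def sum_list_distinct_conv_sum_set atLeast0LessThan)
  also have "\<dots> = card A"
    using assms by (simp add: sum.If_cases Int_absorb1)
  finally show ?thesis
    by (simp add: compositions_def indicator_list_def)
qed

lemma prod_power_indicator_list:
  fixes f :: "nat \<Rightarrow> 'a::comm_ring_1"
  assumes "A \<subseteq> {..<n}"
  shows "(\<Prod>i<n. f i ^ (2 * indicator_list n A ! i)) = (\<Prod>i\<in>A. f i ^ 2)"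
proof -
  have "(\<Prod>i<n. f i ^ (2 * indicator_list n A ! i)) = (\<Prod>i<n. if i \<in> A then f i ^ 2 else 1)"
    by (intro prod.cong) (auto simp: indicator_list_def)
  also have "\<dots> = (\<Prod>i\<in>A. f i ^ 2)"
    using assms by (simp add: prod.If_cases Int_absorb1)
  finally show ?thesis .
qed

definition module_gen :: "nat \<Rightarrow> nat list \<times> (nat \<Rightarrow>\<^sub>0 nat) \<Rightarrow> (nat, 'a::comm_ring_1) mpoly" where
  "module_gen m = (\<lambda>(\<alpha>, \<beta>). square_prod m \<alpha> * power_prod \<beta>)"

abbreviation base_exps :: "nat \<Rightarrow> (nat \<Rightarrow>\<^sub>0 nat) set" where
  "base_exps m \<equiv> exponents (deg_bound m 0)"

abbreviation gen_index :: "nat \<Rightarrow> nat \<Rightarrow> (nat list \<times> (nat \<Rightarrow>\<^sub>0 nat)) set" where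
  "gen_index m k \<equiv> compositions (Suc m) k \<times> base_exps m"

abbreviation gens :: "nat \<Rightarrow> nat \<Rightarrow> (nat, 'a::comm_ring_1) mpoly set" where
  "gens m k \<equiv> module_gen m ` gen_index m k"

lemma finite_base_exps [simp]: "finite (base_exps m)"
  by (rule finite_card_exponents(1)[of m]) (simp add: deg_bound_def)

lemma square_prod_mult_span_gens:
  fixes u :: "(nat, 'a::field) mpoly"
  assumes "u \<in> mpoly.span (gens m k)" "\<alpha> \<in> compositions (Suc m) l"
  shows "square_prod m \<alpha> * u \<in> mpoly.span (gens m (l + k))"
proof -
  let ?W = "{v :: (nat, 'a) mpoly. square_prod m \<alpha> * v \<in> mpoly.span (gens m (l + k))}"
  have "mpoly.span (gens m k) \<subseteq> ?W"
  proof (rule mpoly.span_minimal)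
    show "mpoly.subspace ?W"
    proof (rule mpoly.subspaceI)
      show "0 \<in> ?W"
        by (simp add: mpoly.span_zero)
      show "x + y \<in> ?W" if "x \<in> ?W" "y \<in> ?W" for x y
        using that by (simp add: distrib_left mpoly.span_add)
      show "Const c * x \<in> ?W" if "x \<in> ?W" for c x
        using that mpoly.span_scale[of "square_prod m \<alpha> * x" "gens m (l + k)" c]
        by (simp add: mult.left_commute)
    qed
    show "gens m k \<subseteq> ?W"
    proof
      fix x :: "(nat, 'a) mpoly" assume "x \<in> gens m k"
      then obtain g where g: "g \<in> gen_index m k" "x = module_gen m g"
        by (rule imageE)
      obtain \<alpha>' \<beta> where ab: "g = (\<alpha>', \<beta>)"
        by (cases g)
      have \<alpha>': "\<alpha>' \<in> compositions (Suc m) k"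
        using g by (simp add: ab)
      have "square_prod m \<alpha> * x = module_gen m (map2 (+) \<alpha> \<alpha>', \<beta>)"
        by (simp add: g ab module_gen_def square_prod_add(2)[OF assms(2) \<alpha>'] mult.assoc)
      then have "square_prod m \<alpha> * x \<in> gens m (l + k)"
        using g by (intro image_eqI) (auto simp: ab square_prod_add(1)[OF assms(2) \<alpha>'])
      then show "x \<in> ?W"
        by (simp add: mpoly.span_base)
    qed
  qed
  with assms(1) show ?thesis
    by blast
qed

text \<open>
  Squares are split off one degree at a time, down to the lowest piece of the module.
\<close>

lemma bounded_polys_subset_span_gens:
  fixes p :: "(nat, 'a::field_char_0) mpoly"
  assumes "p \<in> bounded_polys (deg_bound m k)"
  shows "p \<in> mpoly.span (gens m k)"
  using assms
proof (induction k arbitrary: p)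
  case 0
  have "Poly_Mapping.single \<mu> (Poly_Mapping.lookup p \<mu>) \<in> mpoly.span (gens m 0)"
    if "\<mu> \<in> Poly_Mapping.keys p" for \<mu>
  proof -
    have "\<mu> \<in> base_exps m"
      using 0 that by (simp add: bounded_polys_def exponents_def)
    then have "(replicate (Suc m) 0, \<mu>) \<in> gen_index m 0"
      unfolding compositions_0 by (intro SigmaI singletonI)
    moreover have "(power_prod \<mu> :: (nat, 'a) mpoly) = module_gen m (replicate (Suc m) 0, \<mu>)"
      by (auto simp: module_gen_def square_prod_def simp del: replicate.simps)
    ultimately have "(power_prod \<mu> :: (nat, 'a) mpoly) \<in> gens m 0"
      by (metis imageI)
    then have "Const (Poly_Mapping.lookup p \<mu>) * power_prod \<mu> \<in> mpoly.span (gens m 0)"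
      by (intro mpoly.span_scale mpoly.span_base)
    then show ?thesis
      by (simp add: Const_mult_single)
  qed
  then show ?case
    by (subst poly_mapping_expand[of p]) (rule mpoly.span_sum)
next
  case (Suc k)
  have "inj_on (of_nat :: nat \<Rightarrow> 'a) {..<Suc m}"
    by (simp add: inj_on_def)
  then obtain q where q: "\<forall>i\<in>{..<Suc m}. q i \<in> bounded_polys (deg_bound m k)"
    "p = (\<Sum>i<Suc m. root_prod m (of_nat i) ^ 2 * q i)"
    using generated_by_squares[of "{..<Suc m}" m of_nat p k] Suc.prems by auto
  have "root_prod m (of_nat i) ^ 2 * q i \<in> mpoly.span (gens m (Suc k))" if "i < Suc m" for i
  proof -
    have "square_prod m (indicator_list (Suc m) {i}) = (root_prod m (of_nat i) ^ 2 :: (nat, 'a) mpoly)"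
      unfolding square_prod_def using that
        prod_power_indicator_list[of "{i}" "Suc m" "\<lambda>i. root_prod m (of_nat i) :: (nat, 'a) mpoly"]
      by simp
    moreover have "indicator_list (Suc m) {i} \<in> compositions (Suc m) 1"
      using that indicator_list_composition[of "{i}" "Suc m"] by simp
    ultimately show ?thesis
      using square_prod_mult_span_gens[of "q i" m k "indicator_list (Suc m) {i}" 1] Suc.IH q(1) that by simp
  qed
  then show ?case
    unfolding q(2) by (intro mpoly.span_sum) auto
qed

text \<open>
  The generators in degree \<open>k\<close> are exactly as many as the dimension of the graded piece: both numbers are
  \<open>2\<^sup>m m!\<close> times the binomial coefficient of \<open>k + m\<close> over \<open>k\<close>.
\<close>

lemma card_gen_index: "card (gen_index m k) = card (exponents (deg_bound m k))"
proof -
  have "card (exponents (deg_bound m l)) = (\<Prod>j<m. 2 * j + 2 + 2 * l)" for l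
    by (subst finite_card_exponents(2)[of m]) (auto simp: deg_bound_def)
  moreover have "card (compositions (Suc m) k) = (k + m) choose k"
    using card_length_sum_list[of "Suc m" k] by (simp add: compositions_def)
  moreover have "((k + m) choose k) * (\<Prod>j<m. 2 * j + 2) = (\<Prod>j<m. 2 * j + 2 + 2 * k)" for m
  proof (induction m)
    case (Suc m)
    have "Suc m * (Suc (k + m) choose k) = Suc (k + m) * ((k + m) choose k)"
      using binomial_absorb_comp[of "Suc (k + m)" k] by simp
    moreover have "X * (P * (2 * m + 2)) = 2 * (Suc m * X) * P" for X P :: nat
      by (simp add: algebra_simps)
    ultimately have "((k + Suc m) choose k) * (\<Prod>j<Suc m. 2 * j + 2) =
        2 * (Suc (k + m) * ((k + m) choose k)) * (\<Prod>j<m. 2 * j + 2)"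
      by (simp only: prod.lessThan_Suc add_Suc_right)
    also have "\<dots> = (2 * Suc (k + m)) * (((k + m) choose k) * (\<Prod>j<m. 2 * j + 2))"
      by (simp only: mult.assoc)
    also have "\<dots> = (\<Prod>j<Suc m. 2 * j + 2 + 2 * k)"
      unfolding Suc.IH by (simp add: algebra_simps)
    finally show ?case .
  qed simp
  ultimately show ?thesis
    by (simp add: card_cartesian_product)
qed

text \<open>
  A spanning family with as many members as the dimension is a basis. So the module is free over the ring generated
  by the squares.
\<close>

lemma gens_basis:
  shows "inj_on (module_gen m :: _ \<Rightarrow> (nat, 'a::field_char_0) mpoly) (gen_index m k)"
    and "mpoly.independent (gens m k :: (nat, 'a) mpoly set)"
proof -
  let ?G = "gens m k :: (nat, 'a) mpoly set"
  let ?S = "power_prod ` exponents (deg_bound m k) :: (nat, 'a) mpoly set"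
  have fin: "finite ?G"
    by (intro finite_imageI finite_cartesian_product) simp_all
  have "power_prod \<mu> \<in> mpoly.span ?G" if "\<mu> \<in> exponents (deg_bound m k)" for \<mu>
    using that by (intro bounded_polys_subset_span_gens bounded_polys_single) (simp add: exponents_def)
  then have S: "?S \<subseteq> mpoly.span ?G"
    by blast
  have "inj_on (power_prod :: _ \<Rightarrow> (nat, 'a) mpoly) (exponents (deg_bound m k))"
    by (simp add: inj_on_def)
  then have card_S: "card ?S = card (gen_index m k)"
    by (simp only: card_image card_gen_index)
  have "card ?S \<le> card ?G"
    using mpoly.independent_span_bound[OF fin independent_monos S] ..
  moreover have "card ?G \<le> card (gen_index m k)"
    by (intro card_image_le) simp
  ultimately have card_G: "card ?G = card (gen_index m k)"
    using card_S by linarith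
  then show "inj_on (module_gen m :: _ \<Rightarrow> (nat, 'a) mpoly) (gen_index m k)"
    by (intro eq_card_imp_inj_on) simp_all
  show "mpoly.independent ?G"
  proof
    assume "mpoly.dependent ?G"
    then obtain a where a: "a \<in> ?G" "a \<in> mpoly.span (?G - {a})"
      unfolding mpoly.dependent_def by blast
    have "x \<in> mpoly.span (?G - {a})" if "x \<in> ?G" for x
    proof (cases "x = a")
      case False
      with that have "x \<in> ?G - {a}" by blast
      then show ?thesis by (rule mpoly.span_base)
    qed (use a in simp)
    then have "?G \<subseteq> mpoly.span (?G - {a})"
      by (rule subsetI)
    then have "mpoly.span ?G \<subseteq> mpoly.span (?G - {a})"
      by (simp add: mpoly.span_minimal)
    then have "?S \<subseteq> mpoly.span (?G - {a})"
      using S by blast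
    then have "card ?S \<le> card (?G - {a})"
      using mpoly.independent_span_bound[OF _ independent_monos] fin by blast
    then show False
      using a(1) fin card_G card_S by (metis card_Diff1_less leD)
  qed
qed

section \<open>Specialising the squares\<close>

lemma bounded_polys_square_prod:
  assumes "\<alpha> \<in> compositions (Suc m) k"
  shows "square_prod m \<alpha> \<in> bounded_polys (\<lambda>j. if j < m then 2 * k else 0)"
proof -
  have "square_prod m \<alpha> \<in> bounded_polys (\<lambda>j. \<Sum>i<Suc m. (2 * \<alpha> ! i) * (if j < m then 1 else 0))"
    unfolding square_prod_def
    by (intro bounded_polys_prod bounded_polys_power bounded_polys_root_prod)
  moreover have "(\<Sum>i<Suc m. (2 * \<alpha> ! i) * (if j < m then 1 else 0)) \<le> (if j < m then 2 * k else 0)" for j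
    using assms unfolding compositions_def
    by (auto simp: sum_list_sum_nth atLeast0LessThan simp flip: sum_distrib_left simp del: sum.lessThan_Suc)
  ultimately show ?thesis
    by (rule bounded_polys_mono)
qed

lemma bounded_polys_mult_power_prod:
  assumes "w \<in> bounded_polys (\<lambda>j. if j < m then 2 * k else 0)" "\<beta> \<in> base_exps m"
  shows "w * power_prod \<beta> \<in> bounded_polys (deg_bound m k)"
proof -
  have "power_prod \<beta> \<in> bounded_polys (deg_bound m 0)"
    using assms(2) by (intro bounded_polys_single) (simp add: exponents_def)
  then show ?thesis
    by (rule bounded_polys_mono[OF bounded_polys_mult[OF assms(1)]]) (auto simp: deg_bound_def)
qed

lemma bounded_polys_module_gen:
  assumes "g \<in> gen_index m k"
  shows "module_gen m g \<in> bounded_polys (deg_bound m k)"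
proof (cases g)
  case (Pair \<alpha> \<beta>)
  with assms have g: "\<alpha> \<in> compositions (Suc m) k" "\<beta> \<in> base_exps m"
    by simp_all
  show ?thesis
    unfolding Pair module_gen_def prod.case
    by (rule bounded_polys_mult_power_prod[OF bounded_polys_square_prod[OF g(1)] g(2)])
qed

definition coord :: "nat \<Rightarrow> nat \<Rightarrow> nat list \<times> (nat \<Rightarrow>\<^sub>0 nat) \<Rightarrow> (nat, 'a::field_char_0) mpoly \<Rightarrow> 'a" where
  "coord m k g u = mpoly.representation (gens m k) u (module_gen m g)"

lemma coord_linear_combination:
  fixes v :: "'i \<Rightarrow> (nat, 'a::field_char_0) mpoly"
  assumes "\<And>i. i \<in> A \<Longrightarrow> v i \<in> bounded_polys (deg_bound m k)"
  shows "coord m k g (\<Sum>i\<in>A. Const (a i) * v i) = (\<Sum>i\<in>A. a i * coord m k g (v i))"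
proof -
  have v: "v i \<in> mpoly.span (gens m k)" if "i \<in> A" for i
    using assms[OF that] by (rule bounded_polys_subset_span_gens)
  have "mpoly.representation (gens m k) (\<Sum>i\<in>A. Const (a i) * v i) =
      (\<lambda>b. \<Sum>i\<in>A. mpoly.representation (gens m k) (Const (a i) * v i) b)"
    by (intro mpoly.representation_sum gens_basis mpoly.span_scale v)
  also have "\<dots> = (\<lambda>b. \<Sum>i\<in>A. a i * mpoly.representation (gens m k) (v i) b)"
  proof (rule ext, rule sum.cong[OF refl])
    fix b i assume "i \<in> A"
    then show "mpoly.representation (gens m k) (Const (a i) * v i) b = a i * mpoly.representation (gens m k) (v i) b"
      by (simp only: mpoly.representation_scale[OF gens_basis(2) v])
  qed
  finally show ?thesis
    by (simp add: coord_def)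
qed

lemma coord_module_gen:
  assumes "g \<in> gen_index m k" "h \<in> gen_index m k"
  shows "coord m k g (module_gen m h :: (nat, 'a::field_char_0) mpoly) = (if g = h then 1 else 0)"
proof -
  have "coord m k g (module_gen m h :: (nat, 'a) mpoly) = (if module_gen m g = (module_gen m h :: (nat, 'a) mpoly) then 1 else 0)"
    unfolding coord_def by (subst mpoly.representation_basis[OF gens_basis(2)]) (use assms in \<open>auto intro: imageI\<close>)
  then show ?thesis
    using inj_on_eq_iff[OF gens_basis(1)[where 'a = 'a] assms] by simp
qed

lemma coord_expand:
  fixes u :: "(nat, 'a::field_char_0) mpoly"
  assumes "u \<in> bounded_polys (deg_bound m k)"
  shows "u = (\<Sum>g\<in>gen_index m k. Const (coord m k g u) * module_gen m g)"
proof -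
  have "(\<Sum>b\<in>gens m k. Const (mpoly.representation (gens m k) u b) * b) = u"
    by (rule mpoly.sum_representation_eq[OF gens_basis(2) bounded_polys_subset_span_gens[OF assms]])
      (intro finite_imageI finite_cartesian_product finite_compositions finite_base_exps, rule order_refl)
  then show ?thesis
    unfolding coord_def by (subst (asm) sum.reindex[OF gens_basis(1)]) (simp add: o_def)
qed

definition even_power_prod :: "nat \<Rightarrow> (nat \<Rightarrow> 'a::comm_ring_1) \<Rightarrow> nat list \<Rightarrow> 'a" where
  "even_power_prod m c \<alpha> = (\<Prod>i<Suc m. c i ^ (2 * \<alpha> ! i))"

lemma even_power_prod_add:
  assumes "\<alpha> \<in> compositions (Suc m) k" "\<beta> \<in> compositions (Suc m) l"
  shows "even_power_prod m c (map2 (+) \<alpha> \<beta>) = even_power_prod m c \<alpha> * even_power_prod m c \<beta>"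
proof -
  have "c i ^ (2 * map2 (+) \<alpha> \<beta> ! i) = c i ^ (2 * \<alpha> ! i) * c i ^ (2 * \<beta> ! i)" if "i < Suc m" for i
  proof -
    have "map2 (+) \<alpha> \<beta> ! i = \<alpha> ! i + \<beta> ! i"
      using assms that by (simp add: compositions_def)
    then show ?thesis
      by (simp only: distrib_left power_add)
  qed
  then show ?thesis
    unfolding even_power_prod_def prod.distrib[symmetric] by (intro prod.cong refl) simp
qed

text \<open>
  Replaces each square \<open>x\<^sub>i\<^sup>2\<close> by the scalar \<open>c\<^sub>i\<^sup>2\<close>, which is well defined in degree \<open>k\<close> by freeness. The result lies
  in the lowest piece of the module. The degree is an argument because \<open>M\<^sub>k\<close> is contained in \<open>M\<^sub>k\<^sub>+\<^sub>1\<close> as a set of polynomials.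
\<close>

definition specialize ::
  "nat \<Rightarrow> nat \<Rightarrow> (nat \<Rightarrow> 'a) \<Rightarrow> (nat, 'a::field_char_0) mpoly \<Rightarrow> (nat, 'a) mpoly" where
  "specialize m k c u =
     (\<Sum>g\<in>gen_index m k. Const (coord m k g u * even_power_prod m c (fst g)) * power_prod (snd g))"

lemma specialize_linear_combination:
  assumes "\<And>i. i \<in> A \<Longrightarrow> v i \<in> bounded_polys (deg_bound m k)"
  shows "specialize m k c (\<Sum>i\<in>A. Const (a i) * v i) = (\<Sum>i\<in>A. Const (a i) * specialize m k c (v i))"
proof -
  have coord: "coord m k g (\<Sum>i\<in>A. Const (a i) * v i) = (\<Sum>i\<in>A. a i * coord m k g (v i))" for g
    by (rule coord_linear_combination) (rule assms)
  have "specialize m k c (\<Sum>i\<in>A. Const (a i) * v i) =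
      (\<Sum>g\<in>gen_index m k. \<Sum>i\<in>A. Const (a i) *
        (Const (coord m k g (v i) * even_power_prod m c (fst g)) * power_prod (snd g)))"
    unfolding specialize_def coord Const_mult Const_hom.hom_sum sum_distrib_right mult.assoc ..
  also have "\<dots> = (\<Sum>i\<in>A. \<Sum>g\<in>gen_index m k. Const (a i) *
        (Const (coord m k g (v i) * even_power_prod m c (fst g)) * power_prod (snd g)))"
    by (rule sum.swap)
  finally show ?thesis
    unfolding specialize_def sum_distrib_left .
qed

lemma specialize_module_gen:
  fixes c :: "nat \<Rightarrow> 'a::field_char_0"
  assumes "(\<alpha>, \<beta>) \<in> gen_index m k"
  shows "specialize m k c (module_gen m (\<alpha>, \<beta>)) = Const (even_power_prod m c \<alpha>) * power_prod \<beta>"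
proof -
  have "specialize m k c (module_gen m (\<alpha>, \<beta>)) = (\<Sum>g\<in>gen_index m k.
      if g = (\<alpha>, \<beta>) then Const (even_power_prod m c \<alpha>) * power_prod \<beta> else 0)"
    unfolding specialize_def
  proof (rule sum.cong[OF refl])
    fix g assume g: "g \<in> gen_index m k"
    have coord: "coord m k g (module_gen m (\<alpha>, \<beta>) :: (nat, 'a) mpoly) = (if g = (\<alpha>, \<beta>) then 1 else 0)"
      by (rule coord_module_gen[OF g assms])
    show "Const (coord m k g (module_gen m (\<alpha>, \<beta>)) * even_power_prod m c (fst g)) * power_prod (snd g) =
      (if g = (\<alpha>, \<beta>) then Const (even_power_prod m c \<alpha>) * power_prod \<beta> else 0)"
      unfolding coord by simp
  qed
  also have "\<dots> = Const (even_power_prod m c \<alpha>) * power_prod \<beta>"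
    using assms by (subst sum.delta) (auto intro!: finite_cartesian_product)
  finally show ?thesis .
qed

lemma specialize_square_prod_mult:
  fixes u :: "(nat, 'a::field_char_0) mpoly"
  assumes "\<alpha> \<in> compositions (Suc m) l" "u \<in> bounded_polys (deg_bound m k)"
  shows "specialize m (l + k) c (square_prod m \<alpha> * u) = Const (even_power_prod m c \<alpha>) * specialize m k c u"
proof -
  let ?I = "gen_index m k"
  define shift where "shift g = (map2 (+) \<alpha> (fst g), snd g)" for g :: "nat list \<times> (nat \<Rightarrow>\<^sub>0 nat)"
  have shift: "shift g \<in> gen_index m (l + k)"
    "square_prod m \<alpha> * module_gen m g = (module_gen m (shift g) :: (nat, 'a) mpoly)"
    "even_power_prod m c (fst (shift g)) = even_power_prod m c \<alpha> * even_power_prod m c (fst g)"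
    if "g \<in> ?I" for g
  proof -
    have g: "fst g \<in> compositions (Suc m) k" "snd g \<in> base_exps m"
      using that by (simp_all add: mem_Times_iff)
    show "shift g \<in> gen_index m (l + k)"
      using square_prod_add(1)[OF assms(1) g(1)] g(2) by (simp add: shift_def)
    show "square_prod m \<alpha> * module_gen m g = (module_gen m (shift g) :: (nat, 'a) mpoly)"
    proof (cases g)
      case (Pair a b)
      with g have a: "a \<in> compositions (Suc m) k"
        by simp
      show ?thesis
        by (simp only: Pair shift_def module_gen_def prod.case fst_conv snd_conv
            square_prod_add(2)[OF assms(1) a] mult.assoc)
    qed
    show "even_power_prod m c (fst (shift g)) = even_power_prod m c \<alpha> * even_power_prod m c (fst g)"
      unfolding shift_def fst_conv by (rule even_power_prod_add[OF assms(1) g(1)])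
  qed
  have "square_prod m \<alpha> * u = (\<Sum>g\<in>?I. Const (coord m k g u) * module_gen m (shift g))"
    by (subst coord_expand[OF assms(2)], subst sum_distrib_left, intro sum.cong refl)
      (simp only: mult.left_commute[of "square_prod m \<alpha>"] shift(2))
  also have "specialize m (l + k) c \<dots> = (\<Sum>g\<in>?I. Const (coord m k g u) * specialize m (l + k) c (module_gen m (shift g)))"
    by (intro specialize_linear_combination bounded_polys_module_gen shift)
  also have "\<dots> = (\<Sum>g\<in>?I. Const (even_power_prod m c \<alpha>) *
      (Const (coord m k g u) * (Const (even_power_prod m c (fst g)) * power_prod (snd g))))"
  proof (intro sum.cong refl)
    fix g assume g: "g \<in> ?I"
    have "specialize m (l + k) c (module_gen m (fst (shift g), snd (shift g))) =
        Const (even_power_prod m c (fst (shift g))) * power_prod (snd (shift g))"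
      by (rule specialize_module_gen) (simp only: prod.collapse shift(1)[OF g])
    then have "specialize m (l + k) c (module_gen m (shift g)) =
        Const (even_power_prod m c \<alpha>) * (Const (even_power_prod m c (fst g)) * power_prod (snd g))"
      unfolding prod.collapse shift(3)[OF g] Const_mult mult.assoc by (simp only: shift_def snd_conv)
    then show "Const (coord m k g u) * specialize m (l + k) c (module_gen m (shift g)) =
        Const (even_power_prod m c \<alpha>) *
          (Const (coord m k g u) * (Const (even_power_prod m c (fst g)) * power_prod (snd g)))"
      by (simp only: mult.left_commute)
  qed
  also have "\<dots> = Const (even_power_prod m c \<alpha>) * specialize m k c u"
    unfolding specialize_def sum_distrib_left Const_mult mult.assoc
    by (simp only: mult.left_commute)
  finally show ?thesis .
qed

text \<open>
  The squares may be specialised before or after multiplication by \<open>w\<close>: this is what makes the specialised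
  multiplications compose like the original ones.
\<close>

lemma specialize_mult:
  fixes u :: "(nat, 'a::field_char_0) mpoly"
  assumes w: "w \<in> bounded_polys (\<lambda>j. if j < m then 2 * l else 0)"
    and u: "u \<in> bounded_polys (deg_bound m k)"
  shows "specialize m (k + l) c (w * u) = specialize m l c (w * specialize m k c u)"
proof -
  let ?I = "gen_index m k"
  have wb: "w * power_prod (snd g) \<in> bounded_polys (deg_bound m l)" if "g \<in> ?I" for g
    using that by (intro bounded_polys_mult_power_prod[OF w]) auto
  have wg: "square_prod m (fst g) * (w * power_prod (snd g)) \<in> bounded_polys (deg_bound m (k + l))" if "g \<in> ?I" for g
  proof -
    have "square_prod m (fst g) \<in> (bounded_polys (\<lambda>j. if j < m then 2 * k else 0) :: (nat, 'a) mpoly set)"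
      using that by (intro bounded_polys_square_prod) auto
    from bounded_polys_mult[OF this wb[OF that]] show ?thesis
      by (rule bounded_polys_mono) (auto simp: deg_bound_def)
  qed
  have "w * u = (\<Sum>g\<in>?I. Const (coord m k g u) * (square_prod m (fst g) * (w * power_prod (snd g))))"
    by (subst coord_expand[OF u], subst sum_distrib_left, intro sum.cong refl)
      (simp only: module_gen_def split_beta mult_ac)
  also have "specialize m (k + l) c \<dots> = (\<Sum>g\<in>?I. Const (coord m k g u) *
      specialize m (k + l) c (square_prod m (fst g) * (w * power_prod (snd g))))"
    by (intro specialize_linear_combination wg)
  also have "\<dots> = (\<Sum>g\<in>?I. Const (coord m k g u * even_power_prod m c (fst g)) * specialize m l c (w * power_prod (snd g)))"
  proof (intro sum.cong refl)
    fix g assume "g \<in> ?I"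
    then have "specialize m (k + l) c (square_prod m (fst g) * (w * power_prod (snd g))) =
        Const (even_power_prod m c (fst g)) * specialize m l c (w * power_prod (snd g))"
      by (intro specialize_square_prod_mult wb) auto
    then show "Const (coord m k g u) * specialize m (k + l) c (square_prod m (fst g) * (w * power_prod (snd g))) =
        Const (coord m k g u * even_power_prod m c (fst g)) * specialize m l c (w * power_prod (snd g))"
      by (simp only: Const_mult mult.assoc)
  qed
  also have "\<dots> = specialize m l c (\<Sum>g\<in>?I. Const (coord m k g u * even_power_prod m c (fst g)) * (w * power_prod (snd g)))"
    by (rule specialize_linear_combination[symmetric, where v = "\<lambda>g. w * power_prod (snd g)"]) (rule wb)
  also have "(\<Sum>g\<in>?I. Const (coord m k g u * even_power_prod m c (fst g)) * (w * power_prod (snd g))) = w * specialize m k c u"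
    unfolding specialize_def sum_distrib_left by (simp only: mult.left_commute)
  finally show ?thesis .
qed

section \<open>The structure matrices\<close>

definition root_prod_set :: "nat \<Rightarrow> nat set \<Rightarrow> (nat, 'a::comm_ring_1) mpoly" where
  "root_prod_set m S = (\<Prod>i\<in>S. root_prod m (of_nat i))"

lemma bounded_polys_root_prod_set:
  assumes "even (card S)"
  shows "root_prod_set m S \<in> bounded_polys (\<lambda>j. if j < m then 2 * (card S div 2) else 0)"
proof -
  have "root_prod_set m S \<in> bounded_polys (\<lambda>j. \<Sum>i\<in>S. if j < m then 1 else 0)"
    unfolding root_prod_set_def by (intro bounded_polys_prod bounded_polys_root_prod)
  then show ?thesis
    by (rule bounded_polys_mono) (use assms in auto)
qed

lemma root_prod_set_mult:
  assumes "S \<subseteq> {..<Suc m}" "T \<subseteq> {..<Suc m}"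
  shows "(root_prod_set m S * root_prod_set m T :: (nat, 'a::comm_ring_1) mpoly) =
    square_prod m (indicator_list (Suc m) (S \<inter> T)) * root_prod_set m (sym_diff S T)"
proof -
  have fin: "finite S" "finite T"
    using assms by (auto intro: finite_subset)
  have S: "root_prod_set m S = root_prod_set m (S \<inter> T) * root_prod_set m (S - T)"
    unfolding root_prod_set_def by (rule prod.Int_Diff[OF fin(1)])
  have T: "root_prod_set m T = root_prod_set m (S \<inter> T) * root_prod_set m (T - S)"
    unfolding root_prod_set_def Int_commute[of S] by (rule prod.Int_Diff[OF fin(2)])
  have D: "root_prod_set m (sym_diff S T) = root_prod_set m (S - T) * root_prod_set m (T - S)"
    unfolding root_prod_set_def using fin by (intro prod.union_disjoint) auto
  have sq: "square_prod m (indicator_list (Suc m) (S \<inter> T)) = (root_prod_set m (S \<inter> T) ^ 2 :: (nat, 'a) mpoly)"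
    unfolding square_prod_def root_prod_set_def using assms
    by (subst prod_power_indicator_list) (auto simp: prod_power_distrib)
  show ?thesis
    unfolding S T D sq power2_eq_square by (simp only: mult_ac)
qed

lemma card_sym_diff_half:
  assumes "finite S" "finite T" "even (card S)" "even (card T)"
  shows "even (card (sym_diff S T))"
    "card (S \<inter> T) + card (sym_diff S T) div 2 = card T div 2 + card S div 2"
proof -
  have "card S = card (S \<inter> T) + card (S - T)" "card T = card (S \<inter> T) + card (T - S)"
    using card_Int_Diff[OF assms(1), of T] card_Int_Diff[OF assms(2), of S]
    by (simp_all add: Int_commute)
  moreover have "card (sym_diff S T) = card (S - T) + card (T - S)"
    using assms(1,2) by (intro card_Un_disjoint) auto
  ultimately have "card (sym_diff S T) + 2 * card (S \<inter> T) = card S + card T"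
    by simp
  moreover have "even d \<and> i + d div 2 = t div 2 + s div 2"
    if "d + 2 * i = s + t" "even s" "even t" for d i s t :: nat
  proof -
    from that(2,3) obtain a b where ab: "s = 2 * a" "t = 2 * b"
      by (auto elim!: evenE)
    with that(1) have "d = 2 * (a + b - i)" "i \<le> a + b"
      by linarith+
    with ab show ?thesis
      by simp
  qed
  ultimately show "even (card (sym_diff S T))"
    "card (S \<inter> T) + card (sym_diff S T) div 2 = card T div 2 + card S div 2"
    using assms(3,4) by metis+
qed

text \<open>
  The coefficient of the square monomial \<open>\<alpha>\<close> times the basis element \<open>\<beta>'\<close> in \<open>x\<^sub>S\<close> times the basis element \<open>\<beta>\<close>.
\<close>

definition struct_const ::
  "nat \<Rightarrow> nat set \<Rightarrow> nat list \<Rightarrow> (nat \<Rightarrow>\<^sub>0 nat) \<Rightarrow> (nat \<Rightarrow>\<^sub>0 nat) \<Rightarrow> 'a::field_char_0" where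
  "struct_const m S \<alpha> \<beta>' \<beta> = coord m (card S div 2) (\<alpha>, \<beta>') (root_prod_set m S * power_prod \<beta>)"

text \<open>
  The entry of the matrix \<open>X\<^sub>S(c)\<close> of multiplication by \<open>x\<^sub>S\<close> after specialisation.
\<close>

definition struct_entry ::
  "nat \<Rightarrow> (nat \<Rightarrow> 'a) \<Rightarrow> nat set \<Rightarrow> (nat \<Rightarrow>\<^sub>0 nat) \<Rightarrow> (nat \<Rightarrow>\<^sub>0 nat) \<Rightarrow> 'a::field_char_0" where
  "struct_entry m c S \<beta>' \<beta> =
     (\<Sum>\<alpha>\<in>compositions (Suc m) (card S div 2). struct_const m S \<alpha> \<beta>' \<beta> * even_power_prod m c \<alpha>)"

lemma specialize_root_prod_set:
  "specialize m (card S div 2) c (root_prod_set m S * power_prod \<beta>) =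
     (\<Sum>\<beta>'\<in>base_exps m. Const (struct_entry m c S \<beta>' \<beta>) * power_prod \<beta>')"
proof -
  have "specialize m (card S div 2) c (root_prod_set m S * power_prod \<beta>) =
      (\<Sum>\<alpha>\<in>compositions (Suc m) (card S div 2). \<Sum>\<beta>'\<in>base_exps m.
        Const (struct_const m S \<alpha> \<beta>' \<beta> * even_power_prod m c \<alpha>) * power_prod \<beta>')"
    unfolding specialize_def struct_const_def sum.cartesian_product
    by (intro sum.cong refl) (simp add: split_beta)
  also have "\<dots> = (\<Sum>\<beta>'\<in>base_exps m. \<Sum>\<alpha>\<in>compositions (Suc m) (card S div 2).
        Const (struct_const m S \<alpha> \<beta>' \<beta> * even_power_prod m c \<alpha>) * power_prod \<beta>')"
    by (rule sum.swap)
  also have "\<dots> = (\<Sum>\<beta>'\<in>base_exps m. Const (struct_entry m c S \<beta>' \<beta>) * power_prod \<beta>')"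
    unfolding struct_entry_def Const_hom.hom_sum sum_distrib_right ..
  finally show ?thesis .
qed

lemma lookup_sum_power_prod:
  assumes "finite B" "\<beta> \<in> B"
  shows "Poly_Mapping.lookup (\<Sum>\<beta>'\<in>B. Const (a \<beta>') * power_prod \<beta>') \<beta> = (a \<beta> :: 'a::comm_ring_1)"
proof -
  have "Poly_Mapping.lookup (\<Sum>\<beta>'\<in>B. Const (a \<beta>') * power_prod \<beta>') \<beta> = (\<Sum>\<beta>'\<in>B. if \<beta>' = \<beta> then a \<beta> else 0)"
    unfolding lookup_sum by (intro sum.cong) (auto simp: lookup_Const_mult lookup_single when_def)
  then show ?thesis
    using assms by simp
qed

text \<open>
  The rule \<open>x\<^sub>S x\<^sub>T = x\<^sub>S\<^sub>\<inter>\<^sub>T\<^sup>2 x\<^sub>S\<^sub>\<triangle>\<^sub>T\<close>, read in the basis: the left-hand side specialises in two steps, the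
  right-hand side in one.
\<close>

lemma struct_entry_mult:
  fixes c :: "nat \<Rightarrow> 'a::field_char_0"
  assumes S: "S \<subseteq> {..<Suc m}" "even (card S)" and T: "T \<subseteq> {..<Suc m}" "even (card T)"
    and \<beta>: "\<beta> \<in> base_exps m" "\<beta>'' \<in> base_exps m"
  shows "(\<Sum>\<beta>'\<in>base_exps m. struct_entry m c S \<beta>'' \<beta>' * struct_entry m c T \<beta>' \<beta>) =
    (\<Prod>i\<in>S \<inter> T. c i ^ 2) * struct_entry m c (sym_diff S T) \<beta>'' \<beta>"
proof -
  let ?J = "base_exps m" and ?D = "sym_diff S T"
  have fin: "finite S" "finite T"
    using S T by (auto intro: finite_subset)
  note card = card_sym_diff_half[OF fin S(2) T(2)]
  have bounded: "root_prod_set m U * power_prod \<beta> \<in> (bounded_polys (deg_bound m (card U div 2)) :: (nat, 'a) mpoly set)"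
    if "even (card U)" "\<beta> \<in> ?J" for U \<beta>
    using that by (intro bounded_polys_mult_power_prod bounded_polys_root_prod_set)
  have "specialize m (card T div 2 + card S div 2) c (root_prod_set m S * (root_prod_set m T * power_prod \<beta>)) =
      specialize m (card S div 2) c (root_prod_set m S * specialize m (card T div 2) c (root_prod_set m T * power_prod \<beta>))"
    using S T \<beta> by (intro specialize_mult bounded bounded_polys_root_prod_set)
  also have "\<dots> = specialize m (card S div 2) c
      (\<Sum>\<beta>'\<in>?J. Const (struct_entry m c T \<beta>' \<beta>) * (root_prod_set m S * power_prod \<beta>'))"
    by (simp add: specialize_root_prod_set sum_distrib_left mult.left_commute)
  also have "\<dots> = (\<Sum>\<beta>'\<in>?J. Const (struct_entry m c T \<beta>' \<beta>) * specialize m (card S div 2) c (root_prod_set m S * power_prod \<beta>'))"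
    using S by (intro specialize_linear_combination bounded)
  finally have spec: "specialize m (card T div 2 + card S div 2) c (root_prod_set m S * (root_prod_set m T * power_prod \<beta>)) =
      (\<Sum>\<beta>'\<in>?J. Const (struct_entry m c T \<beta>' \<beta>) * specialize m (card S div 2) c (root_prod_set m S * power_prod \<beta>'))" .
  have "Poly_Mapping.lookup (specialize m (card T div 2 + card S div 2) c
        (root_prod_set m S * (root_prod_set m T * power_prod \<beta>))) \<beta>'' =
      (\<Sum>\<beta>'\<in>?J. struct_entry m c T \<beta>' \<beta> *
        Poly_Mapping.lookup (specialize m (card S div 2) c (root_prod_set m S * power_prod \<beta>')) \<beta>'')"
    by (simp only: spec lookup_sum lookup_Const_mult)
  then have lhs: "Poly_Mapping.lookup (specialize m (card T div 2 + card S div 2) c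
        (root_prod_set m S * (root_prod_set m T * power_prod \<beta>))) \<beta>'' =
      (\<Sum>\<beta>'\<in>?J. struct_entry m c T \<beta>' \<beta> * struct_entry m c S \<beta>'' \<beta>')"
    by (simp only: specialize_root_prod_set lookup_sum_power_prod[OF finite_base_exps \<beta>(2)])
  have "root_prod_set m S * (root_prod_set m T * power_prod \<beta>) =
      square_prod m (indicator_list (Suc m) (S \<inter> T)) * (root_prod_set m ?D * power_prod \<beta> :: (nat, 'a) mpoly)"
    by (simp only: root_prod_set_mult[OF S(1) T(1)] flip: mult.assoc)
  then have "specialize m (card T div 2 + card S div 2) c (root_prod_set m S * (root_prod_set m T * power_prod \<beta>)) =
      specialize m (card (S \<inter> T) + card ?D div 2) c
        (square_prod m (indicator_list (Suc m) (S \<inter> T)) * (root_prod_set m ?D * power_prod \<beta>))"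
    by (simp only: card(2))
  also have "\<dots> = Const (even_power_prod m c (indicator_list (Suc m) (S \<inter> T))) *
      specialize m (card ?D div 2) c (root_prod_set m ?D * power_prod \<beta>)"
    using S card(1) \<beta> by (intro specialize_square_prod_mult bounded indicator_list_composition) auto
  also have "even_power_prod m c (indicator_list (Suc m) (S \<inter> T)) = (\<Prod>i\<in>S \<inter> T. c i ^ 2)"
    unfolding even_power_prod_def using S by (intro prod_power_indicator_list) auto
  finally have rhs: "Poly_Mapping.lookup (specialize m (card T div 2 + card S div 2) c
        (root_prod_set m S * (root_prod_set m T * power_prod \<beta>))) \<beta>'' =
      (\<Prod>i\<in>S \<inter> T. c i ^ 2) * struct_entry m c ?D \<beta>'' \<beta>"
    using \<beta> by (simp only: lookup_Const_mult specialize_root_prod_set lookup_sum_power_prod[OF finite_base_exps])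
  show ?thesis
    using lhs rhs by (simp add: mult.commute)
qed

lemma struct_const_empty:
  assumes "\<beta> \<in> base_exps m" "\<beta>' \<in> base_exps m"
  shows "struct_const m {} (replicate (Suc m) 0) \<beta>' \<beta> = (if \<beta>' = \<beta> then 1 else 0 :: 'a::field_char_0)"
proof -
  let ?z = "replicate (Suc m) (0 :: nat)"
  have "?z \<in> compositions (Suc m) 0"
    unfolding compositions_0 by (rule singletonI)
  then have z: "(?z, \<gamma>) \<in> gen_index m 0" if "\<gamma> \<in> base_exps m" for \<gamma>
    using that by (rule SigmaI)
  have "root_prod_set m {} * power_prod \<beta> = (module_gen m (?z, \<beta>) :: (nat, 'a) mpoly)"
    by (simp add: root_prod_set_def module_gen_def square_prod_def del: replicate.simps)
  then have "struct_const m {} ?z \<beta>' \<beta> = coord m 0 (?z, \<beta>') (module_gen m (?z, \<beta>) :: (nat, 'a) mpoly)"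
    by (simp add: struct_const_def del: replicate.simps)
  also have "\<dots> = (if (?z, \<beta>') = (?z, \<beta>) then 1 else 0)"
    by (rule coord_module_gen[OF z[OF assms(2)] z[OF assms(1)]])
  finally show ?thesis
    by simp
qed

section \<open>Sign twists and orthogonality\<close>

definition even_subsets :: "nat \<Rightarrow> nat set set" where
  "even_subsets n = {S. S \<subseteq> {..<n} \<and> even (card S)}"

lemma finite_even_subsets [simp]: "finite (even_subsets n)"
  by (rule finite_subset[of _ "Pow {..<n}"]) (auto simp: even_subsets_def)

definition sign_of :: "nat set \<Rightarrow> nat \<Rightarrow> 'a::comm_ring_1" where
  "sign_of D i = (if i \<in> D then -1 else 1)"

lemma sign_of_square [simp]: "sign_of D i * sign_of D i = 1"
  by (simp add: sign_of_def)

text \<open>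
  The sign \<open>(-1)\<close> to the power \<open>|T|\<close> selects the sets of even size.
\<close>

lemma sum_even_subsets:
  fixes r :: "nat \<Rightarrow> 'a::comm_ring_1"
  shows "2 * (\<Sum>T\<in>even_subsets n. \<Prod>i\<in>{..<n} - T. r i) = (\<Prod>i<n. 1 + r i) + (\<Prod>i<n. -1 + r i)"
proof -
  have "(\<Prod>i<n. 1 + r i) + (\<Prod>i<n. -1 + r i) =
      (\<Sum>T\<in>Pow {..<n}. (1 + (-1) ^ card T) * (\<Prod>i\<in>{..<n} - T. r i))"
    by (simp only: prod_add[OF finite_lessThan] sum.distrib[symmetric] prod_constant distrib_right
        power_one mult_1_left)
  also have "\<dots> = (\<Sum>T\<in>even_subsets n. (1 + (-1) ^ card T) * (\<Prod>i\<in>{..<n} - T. r i))"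
    by (intro sum.mono_neutral_right) (auto simp: even_subsets_def)
  also have "\<dots> = (\<Sum>T\<in>even_subsets n. 2 * (\<Prod>i\<in>{..<n} - T. r i))"
    by (intro sum.cong) (auto simp: even_subsets_def)
  finally show ?thesis
    by (simp add: sum_distrib_left)
qed

lemma sum_even_subsets_signs:
  assumes "D \<subseteq> {1..<Suc m}" "E \<subseteq> {1..<Suc m}"
  shows "(\<Sum>T\<in>even_subsets (Suc m). \<Prod>i\<in>{..<Suc m} - T. sign_of D i * sign_of E i) =
    (if D = E then 2 ^ m else 0 :: 'a::field_char_0)"
proof -
  let ?r = "\<lambda>i. sign_of D i * sign_of E i :: 'a"
  have r0: "?r 0 = 1"
    using assms by (auto simp: sign_of_def)
  have "(\<Prod>i<Suc m. -1 + ?r i) = 0"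
    by (rule prod_zero) (auto simp: r0 intro!: bexI[of _ 0])
  moreover have "(\<Prod>i<Suc m. 1 + ?r i) = (if D = E then 2 ^ Suc m else 0)"
  proof (cases "D = E")
    case False
    then obtain i where i: "i \<in> D \<and> i \<notin> E \<or> i \<in> E \<and> i \<notin> D"
      by blast
    then have "i < Suc m" "1 + ?r i = 0"
      using assms by (auto simp: sign_of_def)
    then have "(\<Prod>i<Suc m. 1 + ?r i) = 0"
      by (intro prod_zero) auto
    with False show ?thesis by simp
  qed simp
  ultimately have "2 * (\<Sum>T\<in>even_subsets (Suc m). \<Prod>i\<in>{..<Suc m} - T. ?r i) = 2 * (if D = E then 2 ^ m else 0)"
    by (subst sum_even_subsets) auto
  then show ?thesis
    by simp
qed

text \<open>
  The entry of \<open>P(\<epsilon> c)\<close>, where \<open>\<epsilon>\<close> is the vector of signs that is \<open>-1\<close> on \<open>D\<close>. The matrices \<open>X\<^sub>S\<close> see only the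
  squares of the entries of \<open>c\<close>, so the signs occur in the factor outside \<open>S\<close> alone.
\<close>

definition twisted_entry ::
  "nat \<Rightarrow> (nat \<Rightarrow> 'a) \<Rightarrow> nat set \<Rightarrow> (nat \<Rightarrow>\<^sub>0 nat) \<Rightarrow> (nat \<Rightarrow>\<^sub>0 nat) \<Rightarrow> 'a::field_char_0" where
  "twisted_entry m c D \<beta>' \<beta> =
     (\<Sum>S\<in>even_subsets (Suc m). (\<Prod>i\<in>{..<Suc m} - S. sign_of D i * c i) * struct_entry m c S \<beta>' \<beta>)"

lemma prod_if_subset:
  fixes f :: "nat \<Rightarrow> 'a::comm_ring_1"
  shows "A \<subseteq> {..<n} \<Longrightarrow> prod f A = (\<Prod>i<n. if i \<in> A then f i else 1)"
  by (subst prod.If_cases) (auto simp: Int_absorb1)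

text \<open>
  The weight of a pair \<open>S\<close>, \<open>T\<close> with symmetric difference \<open>U\<close> separates into a factor that depends on \<open>U\<close> only and a
  product of signs over the complement of \<open>T\<close>.
\<close>

lemma twisted_weight:
  fixes c :: "nat \<Rightarrow> 'a::comm_ring_1"
  assumes "U \<subseteq> {..<n}" "T \<subseteq> {..<n}"
  shows "(\<Prod>i\<in>{..<n} - sym_diff U T. sign_of D i * c i) * (\<Prod>i\<in>{..<n} - T. sign_of E i * c i) *
      (\<Prod>i\<in>sym_diff U T \<inter> T. c i ^ 2) =
    (\<Prod>i<n. sign_of D i * c i) * (\<Prod>i\<in>{..<n} - U. sign_of D i * c i) *
      (\<Prod>i\<in>{..<n} - T. sign_of D i * sign_of E i)"
proof -
  have sub: "{..<n} - sym_diff U T \<subseteq> {..<n}" "{..<n} - T \<subseteq> {..<n}" "sym_diff U T \<inter> T \<subseteq> {..<n}"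
    "{..<n} - U \<subseteq> {..<n}"
    using assms by auto
  show ?thesis
    unfolding prod_if_subset[OF sub(1)] prod_if_subset[OF sub(2)] prod_if_subset[OF sub(3)]
      prod_if_subset[OF sub(4)] prod.distrib[symmetric]
    by (intro prod.cong refl) (auto simp: sign_of_def power2_eq_square)
qed

lemma sym_diff_even_subsets:
  "S \<in> even_subsets n \<Longrightarrow> T \<in> even_subsets n \<Longrightarrow> sym_diff S T \<in> even_subsets n"
  using card_sym_diff_half(1)[of S T] by (auto simp: even_subsets_def intro: finite_subset)

text \<open>
  After collecting the products \<open>X\<^sub>S X\<^sub>T\<close> by \<open>U = S \<triangle> T\<close>, the remaining sum over even \<open>T\<close> is a sum of signs; it vanishes
  unless both twists agree. The index \<open>0\<close> is never twisted, so that a vector of signs is not confused with its negative.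
\<close>

lemma twisted_entry_mult:
  fixes c :: "nat \<Rightarrow> 'a::field_char_0"
  assumes D: "D \<subseteq> {1..<Suc m}" and E: "E \<subseteq> {1..<Suc m}"
    and \<beta>: "\<beta> \<in> base_exps m" "\<beta>'' \<in> base_exps m"
  shows "(\<Sum>\<beta>'\<in>base_exps m. twisted_entry m c D \<beta>'' \<beta>' * twisted_entry m c E \<beta>' \<beta>) =
    (if D = E then 2 ^ m * (\<Prod>i<Suc m. sign_of D i * c i) * twisted_entry m c D \<beta>'' \<beta> else 0)"
proof -
  let ?n = "Suc m" and ?J = "base_exps m"
  let ?w = "\<lambda>D S. \<Prod>i\<in>{..<?n} - S. sign_of D i * c i"
  let ?x = "struct_entry m c"
  have "(\<Sum>\<beta>'\<in>?J. twisted_entry m c D \<beta>'' \<beta>' * twisted_entry m c E \<beta>' \<beta>) =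
      (\<Sum>\<beta>'\<in>?J. \<Sum>S\<in>even_subsets ?n. \<Sum>T\<in>even_subsets ?n. (?w D S * ?w E T) * (?x S \<beta>'' \<beta>' * ?x T \<beta>' \<beta>))"
    unfolding twisted_entry_def sum_product by (intro sum.cong refl) (simp only: mult_ac)
  also have "\<dots> = (\<Sum>S\<in>even_subsets ?n. \<Sum>T\<in>even_subsets ?n. \<Sum>\<beta>'\<in>?J. (?w D S * ?w E T) * (?x S \<beta>'' \<beta>' * ?x T \<beta>' \<beta>))"
    by (subst sum.swap, intro sum.cong refl, rule sum.swap)
  also have "\<dots> = (\<Sum>S\<in>even_subsets ?n. \<Sum>T\<in>even_subsets ?n.
      (?w D S * ?w E T * (\<Prod>i\<in>S \<inter> T. c i ^ 2)) * ?x (sym_diff S T) \<beta>'' \<beta>)"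
  proof (intro sum.cong refl)
    fix S T assume "S \<in> even_subsets ?n" "T \<in> even_subsets ?n"
    then show "(\<Sum>\<beta>'\<in>?J. (?w D S * ?w E T) * (?x S \<beta>'' \<beta>' * ?x T \<beta>' \<beta>)) =
        (?w D S * ?w E T * (\<Prod>i\<in>S \<inter> T. c i ^ 2)) * ?x (sym_diff S T) \<beta>'' \<beta>"
      unfolding sum_distrib_left[symmetric]
      by (subst struct_entry_mult) (use \<beta> in \<open>simp_all only: even_subsets_def mem_Collect_eq mult.assoc\<close>)
  qed
  also have "\<dots> = (\<Sum>T\<in>even_subsets ?n. \<Sum>S\<in>even_subsets ?n.
      (?w D S * ?w E T * (\<Prod>i\<in>S \<inter> T. c i ^ 2)) * ?x (sym_diff S T) \<beta>'' \<beta>)"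
    by (rule sum.swap)
  also have "\<dots> = (\<Sum>T\<in>even_subsets ?n. \<Sum>U\<in>even_subsets ?n.
      (?w D (sym_diff U T) * ?w E T * (\<Prod>i\<in>sym_diff U T \<inter> T. c i ^ 2)) * ?x U \<beta>'' \<beta>)"
  proof (rule sum.cong[OF refl])
    fix T assume T: "T \<in> even_subsets ?n"
    have inv: "sym_diff (sym_diff S T) T = S" for S :: "nat set"
      by blast
    show "(\<Sum>S\<in>even_subsets ?n. (?w D S * ?w E T * (\<Prod>i\<in>S \<inter> T. c i ^ 2)) * ?x (sym_diff S T) \<beta>'' \<beta>) =
      (\<Sum>U\<in>even_subsets ?n. (?w D (sym_diff U T) * ?w E T * (\<Prod>i\<in>sym_diff U T \<inter> T. c i ^ 2)) * ?x U \<beta>'' \<beta>)"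
      by (rule sum.reindex_bij_witness[of _ "\<lambda>U. sym_diff U T" "\<lambda>S. sym_diff S T"])
        (simp_all only: inv sym_diff_even_subsets[OF _ T])
  qed
  also have "\<dots> = (\<Sum>T\<in>even_subsets ?n. \<Sum>U\<in>even_subsets ?n.
      ((\<Prod>i<?n. sign_of D i * c i) * ?w D U * (\<Prod>i\<in>{..<?n} - T. sign_of D i * sign_of E i)) * ?x U \<beta>'' \<beta>)"
    by (intro sum.cong refl, subst twisted_weight) (simp_all add: even_subsets_def)
  also have "\<dots> = (\<Sum>T\<in>even_subsets ?n. (\<Prod>i\<in>{..<?n} - T. sign_of D i * sign_of E i) *
      ((\<Prod>i<?n. sign_of D i * c i) * twisted_entry m c D \<beta>'' \<beta>))"
    unfolding twisted_entry_def sum_distrib_left by (intro sum.cong refl) (simp only: mult_ac)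
  also have "\<dots> = (\<Sum>T\<in>even_subsets ?n. (\<Prod>i\<in>{..<?n} - T. sign_of D i * sign_of E i)) *
      ((\<Prod>i<?n. sign_of D i * c i) * twisted_entry m c D \<beta>'' \<beta>)"
    by (rule sum_distrib_right[symmetric])
  also have "\<dots> = (if D = E then 2 ^ m * (\<Prod>i<Suc m. sign_of D i * c i) * twisted_entry m c D \<beta>'' \<beta> else 0)"
    unfolding sum_even_subsets_signs[OF D E] by simp
  finally show ?thesis .
qed

section \<open>Powers of linear forms and the flattening\<close>

lemma mdegree_superset:
  "finite A \<Longrightarrow> Poly_Mapping.keys e \<subseteq> A \<Longrightarrow> mdegree e = (\<Sum>v\<in>A. Poly_Mapping.lookup e v)"
  unfolding mdegree_def by (intro sum.mono_neutral_left) (auto simp: in_keys_iff)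

lemma keys_minus_subset: "Poly_Mapping.keys (e - f) \<subseteq> Poly_Mapping.keys (e :: 'v \<Rightarrow>\<^sub>0 nat)"
proof
  fix v assume "v \<in> Poly_Mapping.keys (e - f)"
  then have "Poly_Mapping.lookup e v \<noteq> 0"
    by (simp add: in_keys_iff lookup_minus)
  then show "v \<in> Poly_Mapping.keys e"
    by (simp add: in_keys_iff)
qed

lemma lookup_Var_mult:
  "Poly_Mapping.lookup (Var i * p) e =
     (if Poly_Mapping.lookup e i = 0 then 0 else Poly_Mapping.lookup p (e - Poly_Mapping.single i 1))"
proof -
  have shift: "Poly_Mapping.single i 1 + k = e \<longleftrightarrow>
      Poly_Mapping.lookup e i \<noteq> 0 \<and> k = e - Poly_Mapping.single i 1" for k
  proof
    assume "Poly_Mapping.single i 1 + k = e"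
    then show "Poly_Mapping.lookup e i \<noteq> 0 \<and> k = e - Poly_Mapping.single i 1"
      by (auto simp: lookup_add)
  next
    assume "Poly_Mapping.lookup e i \<noteq> 0 \<and> k = e - Poly_Mapping.single i 1"
    then show "Poly_Mapping.single i 1 + k = e"
      by (intro poly_mapping_eqI) (auto simp: lookup_add lookup_minus lookup_single when_def)
  qed
  have "Var i * p = (\<Sum>k\<in>Poly_Mapping.keys p. Poly_Mapping.single (Poly_Mapping.single i 1 + k) (Poly_Mapping.lookup p k))"
    by (subst poly_mapping_expand[of p]) (simp only: sum_distrib_left Var_def mult_single mult_1_left)
  then have "Poly_Mapping.lookup (Var i * p) e =
      (\<Sum>k\<in>Poly_Mapping.keys p. if Poly_Mapping.single i 1 + k = e then Poly_Mapping.lookup p k else 0)"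
    by (simp only: lookup_sum lookup_single when_def)
  also have "\<dots> = (\<Sum>k\<in>Poly_Mapping.keys p. if k = e - Poly_Mapping.single i 1 then
      (if Poly_Mapping.lookup e i = 0 then 0 else Poly_Mapping.lookup p k) else 0)"
    unfolding shift by (intro sum.cong refl) simp
  also have "\<dots> = (if Poly_Mapping.lookup e i = 0 then 0 else Poly_Mapping.lookup p (e - Poly_Mapping.single i 1))"
    by (auto simp: in_keys_iff)
  finally show ?thesis .
qed

text \<open>
  The multinomial coefficient \<open>d! / \<Prod>\<^sub>v e\<^sub>v!\<close> of an exponent vector of degree \<open>d\<close>, and \<open>0\<close> in other degrees.
\<close>

primrec multinomial_coeff :: "nat \<Rightarrow> (nat \<Rightarrow>\<^sub>0 nat) \<Rightarrow> nat" where
  "multinomial_coeff 0 e = (if e = 0 then 1 else 0)"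
| "multinomial_coeff (Suc d) e =
     (\<Sum>i\<in>Poly_Mapping.keys e. multinomial_coeff d (e - Poly_Mapping.single i 1))"

lemma multinomial_coeff_pos: "mdegree e = d \<Longrightarrow> 0 < multinomial_coeff d e"
proof (induction d arbitrary: e)
  case 0
  then have "e = 0"
    by (intro poly_mapping_eqI) (auto simp: mdegree_def in_keys_iff)
  then show ?case by simp
next
  case (Suc d)
  then have "Poly_Mapping.keys e \<noteq> {}"
    by (auto simp: mdegree_def)
  then obtain i where i: "i \<in> Poly_Mapping.keys e"
    by blast
  let ?e = "e - Poly_Mapping.single i 1"
  have "Poly_Mapping.lookup e v = Poly_Mapping.lookup ?e v + (if v = i then 1 else 0)" for v
    using i by (auto simp: lookup_minus lookup_single when_def in_keys_iff)
  moreover have "Poly_Mapping.keys ?e \<subseteq> Poly_Mapping.keys e"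
    by (rule keys_minus_subset)
  ultimately have "mdegree e = mdegree ?e + 1"
    using i by (simp add: mdegree_superset[of "Poly_Mapping.keys e"] sum.distrib)
  then have "0 < multinomial_coeff d ?e"
    using Suc by simp
  then show ?case
    using i by (auto intro: sum_pos2)
qed

lemma lookup_linear_form_power:
  fixes c :: "nat \<Rightarrow> 'a::comm_ring_1"
  assumes "Poly_Mapping.keys e \<subseteq> {..<n}"
  shows "Poly_Mapping.lookup ((\<Sum>i<n. Const (c i) * Var i) ^ d) e =
    of_nat (multinomial_coeff d e) * (\<Prod>i<n. c i ^ Poly_Mapping.lookup e i)"
  using assms
proof (induction d arbitrary: e)
  case 0
  show ?case
    by (cases "e = 0") (simp_all add: lookup_one when_def)
next
  case (Suc d)
  let ?l = "\<Sum>i<n. Const (c i) * Var i"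
  have "Poly_Mapping.lookup (?l ^ Suc d) e = (\<Sum>i<n. c i * Poly_Mapping.lookup (Var i * ?l ^ d) e)"
    by (simp only: power_Suc sum_distrib_right mult.assoc lookup_sum lookup_Const_mult)
  also have "\<dots> = (\<Sum>i\<in>Poly_Mapping.keys e. c i * Poly_Mapping.lookup (?l ^ d) (e - Poly_Mapping.single i 1))"
    using Suc.prems
    by (intro sum.mono_neutral_cong_right) (auto simp: lookup_Var_mult in_keys_iff)
  also have "\<dots> = (\<Sum>i\<in>Poly_Mapping.keys e. of_nat (multinomial_coeff d (e - Poly_Mapping.single i 1)) *
      (\<Prod>i<n. c i ^ Poly_Mapping.lookup e i))"
  proof (rule sum.cong[OF refl])
    fix i assume i: "i \<in> Poly_Mapping.keys e"
    then have "i < n"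
      using Suc.prems by blast
    have "Poly_Mapping.lookup e i \<noteq> 0"
      using i by (simp add: in_keys_iff)
    have "Poly_Mapping.keys (e - Poly_Mapping.single i 1) \<subseteq> {..<n}"
      using keys_minus_subset Suc.prems by (rule subset_trans)
    then have A: "Poly_Mapping.lookup (?l ^ d) (e - Poly_Mapping.single i 1) =
        of_nat (multinomial_coeff d (e - Poly_Mapping.single i 1)) *
        (\<Prod>j<n. c j ^ Poly_Mapping.lookup (e - Poly_Mapping.single i 1) j)"
      by (rule Suc.IH)
    have B: "c i * (\<Prod>j<n. c j ^ Poly_Mapping.lookup (e - Poly_Mapping.single i 1) j) =
        (\<Prod>j<n. c j ^ Poly_Mapping.lookup e j)"
    proof -
      have "c i * (\<Prod>j<n. c j ^ Poly_Mapping.lookup (e - Poly_Mapping.single i 1) j) =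
          (\<Prod>j<n. if j = i then c i else 1) * (\<Prod>j<n. c j ^ Poly_Mapping.lookup (e - Poly_Mapping.single i 1) j)"
        using \<open>i < n\<close> by simp
      also have "\<dots> = (\<Prod>j<n. c j ^ Poly_Mapping.lookup e j)"
        unfolding prod.distrib[symmetric]
      proof (rule prod.cong[OF refl])
        fix j
        show "(if j = i then c i else 1) * c j ^ Poly_Mapping.lookup (e - Poly_Mapping.single i 1) j =
            c j ^ Poly_Mapping.lookup e j"
          using \<open>Poly_Mapping.lookup e i \<noteq> 0\<close>
          by (cases "Poly_Mapping.lookup e i") (auto simp: lookup_minus lookup_single when_def)
      qed
      finally show ?thesis .
    qed
    show "c i * Poly_Mapping.lookup (?l ^ d) (e - Poly_Mapping.single i 1) =
        of_nat (multinomial_coeff d (e - Poly_Mapping.single i 1)) * (\<Prod>i<n. c i ^ Poly_Mapping.lookup e i)"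
      unfolding A mult.left_commute[of "c i"] B ..
  qed
  finally show ?case
    by (simp add: sum_distrib_right)
qed

text \<open>
  The exponent vector of \<open>c\<close> in the term of \<open>P(c)\<close> that belongs to \<open>S\<close> and \<open>\<alpha>\<close>; its odd entries are exactly those
  outside \<open>S\<close>.
\<close>

definition weight_exp :: "nat \<Rightarrow> nat set \<Rightarrow> nat list \<Rightarrow> nat \<Rightarrow>\<^sub>0 nat" where
  "weight_exp n S \<alpha> = (\<Sum>i<n. Poly_Mapping.single i (2 * \<alpha> ! i + (if i \<in> S then 0 else 1)))"

lemma lookup_weight_exp:
  "Poly_Mapping.lookup (weight_exp n S \<alpha>) i = (if i < n then 2 * \<alpha> ! i + (if i \<in> S then 0 else 1) else 0)"
  by (auto simp: weight_exp_def lookup_sum lookup_single when_def)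

lemma weight_exp_monomials:
  assumes "S \<in> even_subsets n" "\<alpha> \<in> compositions n (card S div 2)"
  shows "weight_exp n S \<alpha> \<in> monomials n n"
proof -
  have keys: "Poly_Mapping.keys (weight_exp n S \<alpha>) \<subseteq> {..<n}"
    by (auto simp: in_keys_iff lookup_weight_exp split: if_splits)
  have S: "S \<subseteq> {..<n}" "even (card S)"
    using assms(1) by (auto simp: even_subsets_def)
  have "(\<Sum>i<n. if i \<in> S then 0 else 1) = card ({..<n} - S)"
    by (simp add: sum.If_cases Diff_eq)
  also have "\<dots> = n - card S"
    using S by (simp add: card_Diff_subset finite_subset)
  finally have "mdegree (weight_exp n S \<alpha>) = 2 * (\<Sum>i<n. \<alpha> ! i) + (n - card S)"
    by (simp add: mdegree_superset[OF _ keys] lookup_weight_exp sum.distrib sum_distrib_left)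
  also have "(\<Sum>i<n. \<alpha> ! i) = card S div 2"
    using assms(2) by (auto simp: compositions_def sum_list_sum_nth atLeast0LessThan)
  also have "2 * (card S div 2) + (n - card S) = n"
    using S card_mono[OF _ S(1)] by simp
  finally show ?thesis
    using keys by (simp add: monomials_def)
qed

definition flattening_coeff ::
  "nat \<Rightarrow> nat set \<Rightarrow> nat set \<Rightarrow> nat list \<Rightarrow> (nat \<Rightarrow>\<^sub>0 nat) \<Rightarrow> (nat \<Rightarrow>\<^sub>0 nat) \<Rightarrow> 'a::field_char_0" where
  "flattening_coeff m D S \<alpha> \<beta>' \<beta> =
     (\<Prod>i\<in>{..<Suc m} - S. sign_of D i) * struct_const m S \<alpha> \<beta>' \<beta> /
       of_nat (multinomial_coeff (Suc m) (weight_exp (Suc m) S \<alpha>))"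

text \<open>
  The entry of the flattening. Each monomial \<open>c\<^sup>e\<close> in \<open>P(\<epsilon> c)\<close> is replaced by the coefficient of \<open>x\<^sup>e\<close> in \<open>g\<close>, divided
  by a multinomial coefficient so that the power of \<open>\<Sum>\<^sub>i c\<^sub>i x\<^sub>i\<close> gives back \<open>P(\<epsilon> c)\<close>. The first components of the indices
  number the diagonal blocks, one for each twist.
\<close>

definition flattening ::
  "nat \<Rightarrow> (nat, 'a::field_char_0) mpoly \<Rightarrow> nat set \<times> (nat \<Rightarrow>\<^sub>0 nat) \<Rightarrow> nat set \<times> (nat \<Rightarrow>\<^sub>0 nat) \<Rightarrow> 'a" where
  "flattening m g x y = (if fst x = fst y then
     (\<Sum>S\<in>even_subsets (Suc m). \<Sum>\<alpha>\<in>compositions (Suc m) (card S div 2).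
        flattening_coeff m (fst x) S \<alpha> (snd x) (snd y) * Poly_Mapping.lookup g (weight_exp (Suc m) S \<alpha>)) else 0)"

text \<open>
  The multinomial coefficients in the expansion of a power cancel those in \<open>flattening_coeff\<close>.
\<close>

lemma flattening_sum_powers:
  fixes c :: "nat \<Rightarrow> nat \<Rightarrow> 'a::field_char_0"
  shows "flattening m (\<Sum>j<r. Const (a j) * (\<Sum>i<Suc m. Const (c j i) * Var i) ^ Suc m) x y =
    (\<Sum>j<r. a j * (if fst x = fst y then twisted_entry m (c j) (fst x) (snd x) (snd y) else 0))"
proof (cases "fst x = fst y")
  case True
  let ?n = "Suc m" and ?D = "fst x"
  let ?g = "\<Sum>j<r. Const (a j) * (\<Sum>i<?n. Const (c j i) * Var i) ^ ?n"
  let ?s = "\<lambda>S \<alpha>. struct_const m S \<alpha> (snd x) (snd y) :: 'a"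
  have summand: "flattening_coeff m ?D S \<alpha> (snd x) (snd y) * Poly_Mapping.lookup ?g (weight_exp ?n S \<alpha>) =
      (\<Sum>j<r. a j * ((\<Prod>i\<in>{..<?n} - S. sign_of ?D i * c j i) * (?s S \<alpha> * even_power_prod m (c j) \<alpha>)))"
    if S: "S \<in> even_subsets ?n" and \<alpha>: "\<alpha> \<in> compositions ?n (card S div 2)" for S \<alpha>
  proof -
    let ?e = "weight_exp ?n S \<alpha>"
    let ?\<mu> = "of_nat (multinomial_coeff ?n ?e) :: 'a"
    have e: "Poly_Mapping.keys ?e \<subseteq> {..<?n}" "mdegree ?e = ?n"
      using weight_exp_monomials[OF S \<alpha>] by (auto simp: monomials_def)
    have \<mu>: "?\<mu> \<noteq> 0"
      unfolding of_nat_eq_0_iff using multinomial_coeff_pos[OF e(2)] by (rule gr_implies_not0)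
    have w: "(\<Prod>i<?n. c j i ^ Poly_Mapping.lookup ?e i) = (\<Prod>i\<in>{..<?n} - S. c j i) * even_power_prod m (c j) \<alpha>" for j
    proof -
      have "(\<Prod>i<?n. c j i ^ Poly_Mapping.lookup ?e i) =
          (\<Prod>i<?n. if i \<in> {..<?n} - S then c j i else 1) * (\<Prod>i<?n. c j i ^ (2 * \<alpha> ! i))"
        unfolding prod.distrib[symmetric] by (intro prod.cong refl) (auto simp: lookup_weight_exp)
      also have "(\<Prod>i<?n. if i \<in> {..<?n} - S then c j i else 1) = (\<Prod>i\<in>{..<?n} - S. c j i)"
        by (rule prod_if_subset[symmetric]) auto
      finally show ?thesis
        by (simp only: even_power_prod_def)
    qed
    have g: "Poly_Mapping.lookup ?g ?e = ?\<mu> * (\<Sum>j<r. a j * ((\<Prod>i\<in>{..<?n} - S. c j i) * even_power_prod m (c j) \<alpha>))"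
      unfolding lookup_sum lookup_Const_mult lookup_linear_form_power[OF e(1)] w sum_distrib_left
      by (simp only: mult.left_commute)
    have k: "flattening_coeff m ?D S \<alpha> (snd x) (snd y) * (?\<mu> * Z) =
        (\<Prod>i\<in>{..<?n} - S. sign_of ?D i) * ?s S \<alpha> * Z" for Z
      unfolding flattening_coeff_def using \<mu> by simp
    show ?thesis
      unfolding g k unfolding prod.distrib sum_distrib_left by (intro sum.cong refl) (simp only: mult_ac)
  qed
  have "flattening m ?g x y = (\<Sum>S\<in>even_subsets ?n. \<Sum>\<alpha>\<in>compositions ?n (card S div 2). \<Sum>j<r.
      a j * ((\<Prod>i\<in>{..<?n} - S. sign_of ?D i * c j i) * (?s S \<alpha> * even_power_prod m (c j) \<alpha>)))"
    unfolding flattening_def if_P[OF True] by (intro sum.cong refl summand)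
  also have "\<dots> = (\<Sum>S\<in>even_subsets ?n. \<Sum>j<r. \<Sum>\<alpha>\<in>compositions ?n (card S div 2).
      a j * ((\<Prod>i\<in>{..<?n} - S. sign_of ?D i * c j i) * (?s S \<alpha> * even_power_prod m (c j) \<alpha>)))"
    by (intro sum.cong refl sum.swap)
  also have "\<dots> = (\<Sum>j<r. \<Sum>S\<in>even_subsets ?n. \<Sum>\<alpha>\<in>compositions ?n (card S div 2).
      a j * ((\<Prod>i\<in>{..<?n} - S. sign_of ?D i * c j i) * (?s S \<alpha> * even_power_prod m (c j) \<alpha>)))"
    by (rule sum.swap)
  also have "\<dots> = (\<Sum>j<r. a j * twisted_entry m (c j) ?D (snd x) (snd y))"
    unfolding twisted_entry_def struct_entry_def sum_distrib_left ..
  finally show ?thesis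
    using True by simp
qed (simp add: flattening_def)

lemma lookup_prod_Var:
  fixes n :: nat
  shows "Poly_Mapping.lookup (\<Prod>i<n. Var i) e = (if e = (\<Sum>i<n. Poly_Mapping.single i 1) then 1 else 0 :: 'a::comm_ring_1)"
proof -
  have "(\<Prod>i<n. Var i :: (nat, 'a) mpoly) = Poly_Mapping.single (\<Sum>i<n. Poly_Mapping.single i 1) (\<Prod>i<n. 1)"
    unfolding Var_def by (rule prod_single) simp
  then show ?thesis
    by (simp add: lookup_single when_def eq_commute)
qed

text \<open>
  Only \<open>S = {}\<close> gives a squarefree exponent vector, and there the matrix is the identity. So the flattening of the
  product of the variables is diagonal with nonzero entries.
\<close>

lemma flattening_prod_Var:
  assumes x: "snd x \<in> base_exps m" and y: "snd y \<in> base_exps m"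
  shows "flattening m (\<Prod>i<Suc m. Var i) x y =
    (if x = y then (\<Prod>i<Suc m. sign_of (fst x) i) /
       of_nat (multinomial_coeff (Suc m) (\<Sum>i<Suc m. Poly_Mapping.single i 1)) else 0 :: 'a::field_char_0)"
proof (cases "fst x = fst y")
  case True
  let ?n = "Suc m"
  let ?one = "\<Sum>i<?n. Poly_Mapping.single i (1::nat)"
  let ?z = "replicate ?n (0::nat)"
  have lookup_one: "Poly_Mapping.lookup ?one i = (if i < ?n then 1 else 0)" for i
    by (auto simp: lookup_sum lookup_single when_def simp del: sum.lessThan_Suc)
  have eq: "weight_exp ?n S \<alpha> = ?one \<longleftrightarrow> S = {}" if "S \<in> even_subsets ?n" "\<alpha> \<in> compositions ?n (card S div 2)" for S \<alpha>
  proof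
    assume *: "weight_exp ?n S \<alpha> = ?one"
    have "i \<notin> S" for i
    proof
      assume "i \<in> S"
      moreover from this have "i < ?n"
        using that by (auto simp: even_subsets_def)
      moreover have "Poly_Mapping.lookup (weight_exp ?n S \<alpha>) i = Poly_Mapping.lookup ?one i"
        by (simp only: *)
      ultimately show False
        unfolding lookup_weight_exp lookup_one by simp
    qed
    then show "S = {}" by blast
  next
    assume S: "S = {}"
    then have \<alpha>: "\<alpha> = ?z"
      using that by (simp add: compositions_0 del: replicate.simps)
    show "weight_exp ?n S \<alpha> = ?one"
    proof (rule poly_mapping_eqI)
      show "Poly_Mapping.lookup (weight_exp ?n S \<alpha>) k = Poly_Mapping.lookup ?one k" for k
        unfolding lookup_weight_exp lookup_one S \<alpha> by (simp del: replicate.simps)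
    qed
  qed
  have empty: "{} \<in> even_subsets ?n"
    by (simp add: even_subsets_def)
  have z: "?z \<in> compositions ?n (card ({} :: nat set) div 2)"
    unfolding card.empty div_0 compositions_0 by (rule singletonI)
  have one: "weight_exp ?n {} ?z = ?one"
    using eq[OF empty z] by simp
  have "flattening m (\<Prod>i<?n. Var i) x y = (\<Sum>S\<in>even_subsets ?n. if S = {} then
      (\<Sum>\<alpha>\<in>compositions ?n (card S div 2). flattening_coeff m (fst x) S \<alpha> (snd x) (snd y)) else 0 :: 'a)"
    unfolding flattening_def if_P[OF True] lookup_prod_Var
  proof (rule sum.cong[OF refl])
    fix S assume S: "S \<in> even_subsets ?n"
    have "(\<Sum>\<alpha>\<in>compositions ?n (card S div 2). flattening_coeff m (fst x) S \<alpha> (snd x) (snd y) *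
        (if weight_exp ?n S \<alpha> = ?one then 1 else 0)) =
      (\<Sum>\<alpha>\<in>compositions ?n (card S div 2). flattening_coeff m (fst x) S \<alpha> (snd x) (snd y) *
        (if S = {} then 1 else 0 :: 'a))"
      by (intro sum.cong refl arg_cong2[where f = "(*)"]) (simp only: eq[OF S])
    then show "(\<Sum>\<alpha>\<in>compositions ?n (card S div 2). flattening_coeff m (fst x) S \<alpha> (snd x) (snd y) *
        (if weight_exp ?n S \<alpha> = ?one then 1 else 0)) =
      (if S = {} then \<Sum>\<alpha>\<in>compositions ?n (card S div 2). flattening_coeff m (fst x) S \<alpha> (snd x) (snd y) else 0 :: 'a)"
      by (cases "S = {}") (simp_all only: simp_thms if_True if_False mult_1_right mult_zero_right sum.neutral_const)
  qed
  also have "\<dots> = (\<Sum>\<alpha>\<in>compositions ?n 0. flattening_coeff m (fst x) {} \<alpha> (snd x) (snd y))"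
    using empty by (subst sum.delta) (simp_all del: sum.lessThan_Suc)
  also have "\<dots> = flattening_coeff m (fst x) {} ?z (snd x) (snd y)"
    unfolding compositions_0 by (simp del: replicate.simps)
  also have "\<dots> = (\<Prod>i<?n. sign_of (fst x) i) * (if snd x = snd y then 1 else 0) / of_nat (multinomial_coeff ?n ?one)"
    unfolding flattening_coeff_def one struct_const_empty[OF y x] Diff_empty ..
  finally show ?thesis
    using True by (simp add: prod_eq_iff del: sum.lessThan_Suc prod.lessThan_Suc)
qed (auto simp: flattening_def)

section \<open>Determinants of matrices of low rank\<close>

text \<open>
  Such a matrix is a product of two square matrices, one of which has a zero row.
\<close>

lemma det_low_rank:
  fixes V :: "nat \<Rightarrow> 'k \<Rightarrow> 'a::comm_ring_1"
  assumes "finite K" "card K < N"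
  shows "det (mat N N (\<lambda>(p, q). \<Sum>k\<in>K. V p k * U k q)) = 0"
proof -
  obtain h where h: "bij_betw h {0..<card K} K"
    using ex_bij_betw_nat_finite[OF assms(1)] by blast
  define V' where "V' = mat N N (\<lambda>(p, k). if k < card K then V p (h k) else 0)"
  define U' where "U' = mat N N (\<lambda>(k, q). if k < card K then U (h k) q else 0)"
  have "(\<Sum>k\<in>K. V p k * U k q) = (V' * U') $$ (p, q)" if "p < N" "q < N" for p q
  proof -
    have "(V' * U') $$ (p, q) = (\<Sum>k = 0..<N. if k < card K then V p (h k) * U (h k) q else 0)"
      using that by (auto simp: V'_def U'_def scalar_prod_def intro!: sum.cong)
    also have "\<dots> = (\<Sum>k = 0..<card K. V p (h k) * U (h k) q)"
      using assms(2) by (intro sum.mono_neutral_cong_right) auto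
    also have "\<dots> = (\<Sum>k\<in>K. V p k * U k q)"
      by (rule sum.reindex_bij_betw[OF h])
    finally show ?thesis ..
  qed
  then have eq: "mat N N (\<lambda>(p, q). \<Sum>k\<in>K. V p k * U k q) = V' * U'"
    by (intro eq_matI) (simp_all add: V'_def U'_def)
  have carrier: "V' \<in> carrier_mat N N" "U' \<in> carrier_mat N N"
    by (simp_all add: V'_def U'_def)
  have "det U' = 0"
    unfolding det_def'[OF carrier(2)]
  proof (rule sum.neutral, rule ballI)
    fix p assume "p \<in> {p. p permutes {0..<N}}"
    then have "p (card K) < N"
      using assms(2) permutes_in_image[of p "{0..<N}" "card K"] by simp
    then have "(\<Prod>i = 0..<N. U' $$ (i, p i)) = 0"
      using assms(2) by (intro prod_zero) (auto simp: U'_def intro!: bexI[of _ "card K"])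
    then show "signof p * (\<Prod>i = 0..<N. U' $$ (i, p i)) = 0"
      by simp
  qed
  then show ?thesis
    unfolding eq det_mult[OF carrier] by simp
qed

section \<open>The flattening of a short sum of powers is singular\<close>

definition flattening_index :: "nat \<Rightarrow> (nat set \<times> (nat \<Rightarrow>\<^sub>0 nat)) set" where
  "flattening_index m = Pow {1..<Suc m} \<times> base_exps m"

lemma finite_flattening_index [simp]: "finite (flattening_index m)"
  unfolding flattening_index_def by (intro finite_cartesian_product) simp_all

lemma card_flattening_index: "card (flattening_index m) = 2 ^ m * card (base_exps m)"
  by (simp add: flattening_index_def card_cartesian_product card_Pow)

lemma card_base_exps_pos: "0 < card (base_exps m)"
proof -
  have "0 \<in> base_exps m"
    by (simp add: exponents_def)
  then show ?thesis
    by (auto simp: card_gt_0_iff)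
qed

text \<open>
  If no coordinate is \<open>0\<close>, the relation \<open>P(\<epsilon> c) P(\<epsilon>' c) = 0\<close> or \<open>2\<^sup>m (\<Prod>\<^sub>i \<epsilon>\<^sub>i c\<^sub>i) P(\<epsilon> c)\<close> reads, after division, as a factorisation of
  the block diagonal matrix through the space of one block. A sum of \<open>r\<close> such matrices factors through \<open>r\<close> blocks, which is
  too little if \<open>r < 2\<^sup>m\<close>.
\<close>

lemma det_twisted_eq_0_generic:
  fixes c :: "nat \<Rightarrow> nat \<Rightarrow> 'a::field_char_0"
  assumes r: "r < 2 ^ m" and N: "N = card (flattening_index m)"
    and h: "\<And>p. p < N \<Longrightarrow> h p \<in> flattening_index m"
    and nz: "\<And>j i. j < r \<Longrightarrow> i < Suc m \<Longrightarrow> c j i \<noteq> 0"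
  shows "det (mat N N (\<lambda>(p, q). \<Sum>j<r. a j *
    (if fst (h p) = fst (h q) then twisted_entry m (c j) (fst (h p)) (snd (h p)) (snd (h q)) else 0))) = 0"
proof -
  let ?J = "base_exps m"
  let ?W = "\<lambda>j D. 2 ^ m * (\<Prod>i<Suc m. sign_of D i * c j i)"
  let ?V = "\<lambda>p (j, \<gamma>). a j * twisted_entry m (c j) (fst (h p)) (snd (h p)) \<gamma> / ?W j (fst (h p))"
  let ?U = "\<lambda>(j, \<gamma>) q. twisted_entry m (c j) (fst (h q)) \<gamma> (snd (h q))"
  have "(\<Sum>j<r. a j * (if fst (h p) = fst (h q) then twisted_entry m (c j) (fst (h p)) (snd (h p)) (snd (h q)) else 0)) =
      (\<Sum>k\<in>{..<r} \<times> ?J. ?V p k * ?U k q)" if "p < N" "q < N" for p q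
  proof -
    have p: "fst (h p) \<subseteq> {1..<Suc m}" "snd (h p) \<in> ?J" and q: "fst (h q) \<subseteq> {1..<Suc m}" "snd (h q) \<in> ?J"
      using h[OF that(1)] h[OF that(2)] by (auto simp: flattening_index_def)
    have "(\<Sum>k\<in>{..<r} \<times> ?J. ?V p k * ?U k q) = (\<Sum>j<r. \<Sum>\<gamma>\<in>?J.
        (a j * twisted_entry m (c j) (fst (h p)) (snd (h p)) \<gamma> / ?W j (fst (h p))) *
        twisted_entry m (c j) (fst (h q)) \<gamma> (snd (h q)))"
      unfolding sum.cartesian_product by (intro sum.cong refl) (simp add: split_beta)
    also have "\<dots> = (\<Sum>j<r. a j / ?W j (fst (h p)) * (\<Sum>\<gamma>\<in>?J.
        twisted_entry m (c j) (fst (h p)) (snd (h p)) \<gamma> * twisted_entry m (c j) (fst (h q)) \<gamma> (snd (h q))))"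
      unfolding sum_distrib_left by (intro sum.cong refl) (simp only: times_divide_eq_left mult.assoc)
    also have "\<dots> = (\<Sum>j<r. a j * (if fst (h p) = fst (h q) then twisted_entry m (c j) (fst (h p)) (snd (h p)) (snd (h q)) else 0))"
    proof (rule sum.cong[OF refl])
      fix j assume "j \<in> {..<r}"
      then have "(\<Prod>i<Suc m. sign_of D i * c j i) \<noteq> 0" for D
        using nz[of j] by (auto simp: sign_of_def simp del: prod.lessThan_Suc)
      then have "?W j D \<noteq> 0" for D
        by simp
      then have cancel: "a j / ?W j D * (?W j D * t) = a j * t" for D t
        by (simp only: times_divide_eq_left times_divide_eq_right mult.left_commute[of "a j"]
            nonzero_mult_div_cancel_left not_False_eq_True)
      show "a j / ?W j (fst (h p)) * (\<Sum>\<gamma>\<in>?J.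
          twisted_entry m (c j) (fst (h p)) (snd (h p)) \<gamma> * twisted_entry m (c j) (fst (h q)) \<gamma> (snd (h q))) =
        a j * (if fst (h p) = fst (h q) then twisted_entry m (c j) (fst (h p)) (snd (h p)) (snd (h q)) else 0)"
        unfolding twisted_entry_mult[OF p(1) q(1) q(2) p(2)]
        by (cases "fst (h p) = fst (h q)") (simp_all only: if_True if_False cancel mult_zero_right refl)
    qed
    finally show ?thesis ..
  qed
  then have eq: "mat N N (\<lambda>(p, q). \<Sum>j<r. a j *
    (if fst (h p) = fst (h q) then twisted_entry m (c j) (fst (h p)) (snd (h p)) (snd (h q)) else 0)) =
    mat N N (\<lambda>(p, q). \<Sum>k\<in>{..<r} \<times> ?J. ?V p k * ?U k q)"
    by (intro eq_matI) simp_all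
  \<comment> \<open>One block of size \<open>card ?J\<close> for each of the \<open>r\<close> powers, against \<open>2\<^sup>m\<close> blocks in the matrix.\<close>
  have "card ({..<r} \<times> ?J) < N"
    unfolding N card_flattening_index using r card_base_exps_pos[of m] by (simp add: card_cartesian_product)
  then show ?thesis
    unfolding eq by (intro det_low_rank finite_cartesian_product) simp_all
qed

text \<open>
  The same expression as \<open>twisted_entry\<close>, with univariate polynomials as coordinates.
\<close>

definition twisted_entry_poly ::
  "nat \<Rightarrow> (nat \<Rightarrow> 'a poly) \<Rightarrow> nat set \<Rightarrow> (nat \<Rightarrow>\<^sub>0 nat) \<Rightarrow> (nat \<Rightarrow>\<^sub>0 nat) \<Rightarrow> 'a::field_char_0 poly" where
  "twisted_entry_poly m c D \<beta>' \<beta> =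
     (\<Sum>S\<in>even_subsets (Suc m). (\<Prod>i\<in>{..<Suc m} - S. [:sign_of D i:] * c i) *
       (\<Sum>\<alpha>\<in>compositions (Suc m) (card S div 2). [:struct_const m S \<alpha> \<beta>' \<beta>:] * even_power_prod m c \<alpha>))"

lemma poly_twisted_entry_poly:
  "poly (twisted_entry_poly m c D \<beta>' \<beta>) s = twisted_entry m (\<lambda>i. poly (c i) s) D \<beta>' \<beta>"
proof -
  have const: "poly [:a:] s = a" for a
    by simp
  show ?thesis
    unfolding twisted_entry_poly_def twisted_entry_def struct_entry_def even_power_prod_def
      poly_sum poly_mult poly_prod poly_power const ..
qed

lemma poly_eval_hom: "comm_ring_hom (\<lambda>p. poly p (s :: 'a::comm_ring_1))"
  by unfold_locales auto

text \<open>
  Adding one scalar \<open>s\<close> to all coordinates makes them all nonzero except for finitely many \<open>s\<close>. The determinant is a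
  polynomial in \<open>s\<close>, so it vanishes at \<open>s = 0\<close> too.
\<close>

lemma det_twisted_eq_0:
  fixes c :: "nat \<Rightarrow> nat \<Rightarrow> 'a::field_char_0"
  assumes r: "r < 2 ^ m" and N: "N = card (flattening_index m)"
    and h: "\<And>p. p < N \<Longrightarrow> h p \<in> flattening_index m"
  shows "det (mat N N (\<lambda>(p, q). \<Sum>j<r. a j *
    (if fst (h p) = fst (h q) then twisted_entry m (c j) (fst (h p)) (snd (h p)) (snd (h q)) else 0))) = 0"
proof -
  let ?A = "\<lambda>c. mat N N (\<lambda>(p, q). \<Sum>j<r. a j *
    (if fst (h p) = fst (h q) then twisted_entry m (c j) (fst (h p)) (snd (h p)) (snd (h q)) else 0))"
  define B where "B = mat N N (\<lambda>(p, q). \<Sum>j<r. [:a j:] *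
    (if fst (h p) = fst (h q) then twisted_entry_poly m (\<lambda>i. [:c j i, 1:]) (fst (h p)) (snd (h p)) (snd (h q)) else 0))"
  have "map_mat (\<lambda>p. poly p s) B = ?A (\<lambda>j i. c j i + s)" for s
    by (rule eq_matI) (simp_all add: B_def poly_sum poly_twisted_entry_poly if_distrib[of "\<lambda>p. poly p s"] cong: if_cong)
  then have eval: "poly (det B) s = det (?A (\<lambda>j i. c j i + s))" for s
    using comm_ring_hom.hom_det[OF poly_eval_hom, of s B] by simp
  have "poly (det B) s = 0" if "s \<notin> (\<lambda>(j, i). - c j i) ` ({..<r} \<times> {..<Suc m})" for s
  proof -
    have "c j i + s \<noteq> 0" if "j < r" "i < Suc m" for j i
    proof
      assume "c j i + s = 0"
      then have "s = (\<lambda>(j, i). - c j i) (j, i)"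
        by (simp add: eq_neg_iff_add_eq_0 add.commute)
      then have "s \<in> (\<lambda>(j, i). - c j i) ` ({..<r} \<times> {..<Suc m})"
        by (rule image_eqI) (use that in simp)
      with \<open>s \<notin> _\<close> show False by simp
    qed
    then show ?thesis
      unfolding eval by (intro det_twisted_eq_0_generic r N h)
  qed
  then have "- ((\<lambda>(j, i). - c j i) ` ({..<r} \<times> {..<Suc m})) \<subseteq> {s. poly (det B) s = 0}"
    by blast
  moreover have "infinite (- ((\<lambda>(j, i). - c j i) ` ({..<r} \<times> {..<Suc m})))"
    unfolding Compl_eq_Diff_UNIV
    by (intro Diff_infinite_finite finite_imageI finite_cartesian_product infinite_UNIV_char_0) simp_all
  ultimately have "infinite {s. poly (det B) s = 0}"
    using finite_subset by blast
  then have "det B = 0"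
    using poly_roots_finite by blast
  then show ?thesis
    using eval[of 0] unfolding add_0_right by simp
qed

section \<open>Evaluation of polynomials in the coefficients\<close>

definition power_eval :: "('v \<Rightarrow> 'a::comm_ring_1) \<Rightarrow> ('v \<Rightarrow>\<^sub>0 nat) \<Rightarrow> 'a" where
  "power_eval x m = (\<Prod>v\<in>Poly_Mapping.keys m. x v ^ Poly_Mapping.lookup m v)"

lemma power_eval_superset:
  "finite A \<Longrightarrow> Poly_Mapping.keys m \<subseteq> A \<Longrightarrow> power_eval x m = (\<Prod>v\<in>A. x v ^ Poly_Mapping.lookup m v)"
  unfolding power_eval_def by (intro prod.mono_neutral_left) (auto simp: in_keys_iff)

lemma power_eval_add: "power_eval x (m + m') = power_eval x m * power_eval x m'"
proof -
  let ?A = "Poly_Mapping.keys m \<union> Poly_Mapping.keys m'"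
  have "power_eval x (m + m') = (\<Prod>v\<in>?A. x v ^ Poly_Mapping.lookup (m + m') v)"
    using keys_add[of m m'] by (intro power_eval_superset) auto
  then show ?thesis
    by (simp add: power_eval_superset[of ?A] lookup_add power_add prod.distrib)
qed

lemma mpoly_eval_superset:
  "finite M \<Longrightarrow> Poly_Mapping.keys p \<subseteq> M \<Longrightarrow>
     mpoly_eval x p = (\<Sum>m\<in>M. Poly_Mapping.lookup p m * power_eval x m)"
  unfolding mpoly_eval_def power_eval_def by (intro sum.mono_neutral_left) (auto simp: in_keys_iff)

lemma mpoly_eval_single: "mpoly_eval x (Poly_Mapping.single m c) = c * power_eval x m"
  by (subst mpoly_eval_superset[of "{m}"]) auto

lemma mpoly_eval_add: "mpoly_eval x (p + q) = mpoly_eval x p + mpoly_eval x q"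
proof -
  let ?M = "Poly_Mapping.keys p \<union> Poly_Mapping.keys q"
  have "mpoly_eval x (p + q) = (\<Sum>m\<in>?M. Poly_Mapping.lookup (p + q) m * power_eval x m)"
    using keys_add[of p q] by (intro mpoly_eval_superset) auto
  then show ?thesis
    by (simp add: mpoly_eval_superset[of ?M] lookup_add ring_distribs sum.distrib)
qed

lemma mpoly_eval_sum: "mpoly_eval x (sum f A) = (\<Sum>i\<in>A. mpoly_eval x (f i))"
  by (induction A rule: infinite_finite_induct) (simp_all add: mpoly_eval_add, simp_all add: mpoly_eval_def)

lemma mpoly_eval_mult: "mpoly_eval x (p * q) = mpoly_eval x p * mpoly_eval x q"
proof -
  have "p * q = (\<Sum>k\<in>Poly_Mapping.keys p. \<Sum>l\<in>Poly_Mapping.keys q.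
      Poly_Mapping.single (k + l) (Poly_Mapping.lookup p k * Poly_Mapping.lookup q l))"
    by (subst (1) poly_mapping_expand[of p], subst (1) poly_mapping_expand[of q])
      (simp only: sum_product mult_single)
  then have "mpoly_eval x (p * q) = (\<Sum>k\<in>Poly_Mapping.keys p. \<Sum>l\<in>Poly_Mapping.keys q.
      (Poly_Mapping.lookup p k * power_eval x k) * (Poly_Mapping.lookup q l * power_eval x l))"
    by (simp only: mpoly_eval_sum mpoly_eval_single power_eval_add mult_ac)
  also have "\<dots> = mpoly_eval x p * mpoly_eval x q"
    unfolding sum_product[symmetric] by (simp only: mpoly_eval_superset[OF finite_keys order_refl])
  finally show ?thesis .
qed

lemma mpoly_eval_Const [simp]: "mpoly_eval x (Const c) = c"
  by (simp add: Const_def mpoly_eval_single power_eval_def)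

lemma mpoly_eval_Var [simp]: "mpoly_eval x (Var v) = x v"
  by (simp add: Var_def mpoly_eval_single power_eval_def)

lemma mpoly_eval_hom: "comm_ring_hom (mpoly_eval x :: ('v, 'a::comm_ring_1) mpoly \<Rightarrow> 'a)"
proof
  show "mpoly_eval x (0 :: ('v, 'a) mpoly) = 0"
    by (simp add: mpoly_eval_def)
  show "mpoly_eval x (1 :: ('v, 'a) mpoly) = 1"
    using mpoly_eval_Const[of x 1] by simp
qed (simp_all add: mpoly_eval_add mpoly_eval_mult)

definition polys_in :: "'v set \<Rightarrow> ('v, 'a::comm_ring_1) mpoly set" where
  "polys_in V = {p. \<forall>t\<in>Poly_Mapping.keys p. Poly_Mapping.keys t \<subseteq> V}"

lemma polys_in_Const [simp]: "Const c \<in> polys_in V"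
  by (simp add: polys_in_def Const_def)

lemma polys_in_0_1 [simp]: "0 \<in> polys_in V" "1 \<in> polys_in V"
  using polys_in_Const[of 0 V] polys_in_Const[of 1 V] by simp_all

lemma polys_in_Var: "v \<in> V \<Longrightarrow> Var v \<in> polys_in V"
  by (simp add: polys_in_def Var_def)

lemma polys_in_add: "p \<in> polys_in V \<Longrightarrow> q \<in> polys_in V \<Longrightarrow> p + q \<in> polys_in V"
  using keys_add[of p q] unfolding polys_in_def by blast

lemma polys_in_mult:
  assumes "p \<in> polys_in V" "q \<in> polys_in V"
  shows "p * q \<in> polys_in V"
  unfolding polys_in_def
proof (intro CollectI ballI)
  fix t assume "t \<in> Poly_Mapping.keys (p * q)"
  then obtain a b where "t = a + b" "a \<in> Poly_Mapping.keys p" "b \<in> Poly_Mapping.keys q"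
    using keys_mult[of p q] by blast
  then show "Poly_Mapping.keys t \<subseteq> V"
    using assms keys_add[of a b] unfolding polys_in_def by blast
qed

lemma polys_in_sum: "(\<And>i. i \<in> A \<Longrightarrow> f i \<in> polys_in V) \<Longrightarrow> sum f A \<in> polys_in V"
  by (induction A rule: infinite_finite_induct) (simp_all add: polys_in_add)

lemma polys_in_prod: "(\<And>i. i \<in> A \<Longrightarrow> f i \<in> polys_in V) \<Longrightarrow> prod f A \<in> polys_in V"
  by (induction A rule: infinite_finite_induct) (simp_all add: polys_in_mult)

lemma polys_in_det:
  assumes "A \<in> carrier_mat N N" "\<And>p q. p < N \<Longrightarrow> q < N \<Longrightarrow> A $$ (p, q) \<in> polys_in V"
  shows "det A \<in> polys_in V"
  unfolding det_def'[OF assms(1)]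
proof (intro polys_in_sum polys_in_mult polys_in_prod)
  fix p :: "nat \<Rightarrow> nat"
  have "signof p = (Const (signof p) :: ('a, 'b) mpoly)"
    by (simp add: sign_def Const_hom.hom_uminus)
  then show "signof p \<in> (polys_in V :: ('a, 'b) mpoly set)"
    by (metis polys_in_Const)
next
  fix p i assume "p \<in> {p. p permutes {0..<N}}" "i \<in> {0..<N}"
  then show "A $$ (i, p i) \<in> polys_in V"
    using assms(2)[of i "p i"] permutes_in_image[of p "{0..<N}" i] by simp
qed

section \<open>The lower bound\<close>

lemma forms_1_expand:
  assumes "l \<in> forms n 1"
  shows "l = (\<Sum>i<n. Const (linear_coord l i) * Var i)"
proof -
  have "Const (linear_coord l i) * Var i = Poly_Mapping.single (Poly_Mapping.single i 1) (linear_coord l i)" for i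
    by (simp add: Var_def Const_mult_single)
  then show ?thesis
    using linear_form_expand[OF assms] by simp
qed

text \<open>
  The infimum that defines the rank is attained, unless it is infinite.
\<close>

lemma waring_rank_leD:
  fixes g :: "(nat, 'a::field_char_0) mpoly"
  assumes "waring_rank n d g \<le> enat r"
  obtains s a c where "s \<le> r" "g = (\<Sum>j<s. Const (a j) * (\<Sum>i<n. Const (c j i) * Var i) ^ d)"
proof -
  let ?X = "{enat r | r. \<exists>a l. (\<forall>i<r. l i \<in> forms n 1) \<and> g = (\<Sum>i<r. Const (a i) * l i ^ d)}"
  have "?X \<noteq> {}"
  proof
    assume "?X = {}"
    then have "waring_rank n d g = \<infinity>"
      unfolding waring_rank_def Inf_enat_def by (simp only: simp_thms if_True)
    with assms show False by simp
  qed
  moreover have least: "Inf X \<in> X" if "X \<noteq> {}" for X :: "enat set"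
    using that LeastI_ex[of "\<lambda>x. x \<in> X"] by (simp add: Inf_enat_def ex_in_conv)
  ultimately have "waring_rank n d g \<in> ?X"
    unfolding waring_rank_def by (intro least)
  then obtain s a l where s: "waring_rank n d g = enat s" "\<forall>i<s. l i \<in> forms n 1"
    "g = (\<Sum>i<s. Const (a i) * l i ^ d)"
    unfolding mem_Collect_eq by (elim exE conjE) (rule that)
  have "g = (\<Sum>j<s. Const (a j) * (\<Sum>i<n. Const (linear_coord (l j) i) * Var i) ^ d)"
    unfolding s(3)
  proof (rule sum.cong[OF refl])
    fix j assume "j \<in> {..<s}"
    then have "l j = (\<Sum>i<n. Const (linear_coord (l j) i) * Var i)"
      using s(2) by (intro forms_1_expand) blast
    then show "Const (a j) * l j ^ d = Const (a j) * (\<Sum>i<n. Const (linear_coord (l j) i) * Var i) ^ d"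
      by (rule arg_cong)
  qed
  with that[of s a "\<lambda>j i. linear_coord (l j) i"] s(1) assms show thesis
    by simp
qed

text \<open>
  The entry of the flattening as a linear polynomial in the coefficients of the form.
\<close>

definition flattening_poly ::
  "nat \<Rightarrow> nat set \<times> (nat \<Rightarrow>\<^sub>0 nat) \<Rightarrow> nat set \<times> (nat \<Rightarrow>\<^sub>0 nat) \<Rightarrow> (nat \<Rightarrow>\<^sub>0 nat, 'a::field_char_0) mpoly" where
  "flattening_poly m x y = (if fst x = fst y then
     (\<Sum>S\<in>even_subsets (Suc m). \<Sum>\<alpha>\<in>compositions (Suc m) (card S div 2).
        Const (flattening_coeff m (fst x) S \<alpha> (snd x) (snd y)) * Var (weight_exp (Suc m) S \<alpha>)) else 0)"

lemma mpoly_eval_zero: "mpoly_eval x 0 = 0"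
  by (simp add: mpoly_eval_def)

lemma mpoly_eval_flattening_poly:
  "mpoly_eval (Poly_Mapping.lookup g) (flattening_poly m x y) = flattening m g x y"
  unfolding flattening_poly_def flattening_def
  by (cases "fst x = fst y")
    (simp_all only: simp_thms if_True if_False mpoly_eval_sum mpoly_eval_mult mpoly_eval_Const mpoly_eval_Var
      mpoly_eval_zero)

lemma flattening_poly_polys_in:
  "flattening_poly m x y \<in> polys_in (monomials (Suc m) (Suc m))"
proof (cases "fst x = fst y")
  case True
  show ?thesis
    unfolding flattening_poly_def if_P[OF True]
    by (intro polys_in_sum polys_in_mult polys_in_Const polys_in_Var weight_exp_monomials)
qed (simp add: flattening_poly_def)

lemma zariski_closed_hypersurface:
  assumes "P \<in> polys_in (monomials n d)"
  shows "zariski_closed n d {f \<in> forms n d. mpoly_eval (Poly_Mapping.lookup f) P = 0}"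
  unfolding zariski_closed_def using assms
  by (intro exI[of _ "{P}"]) (auto simp: polys_in_def)

lemma prod_Var_in_forms: "(\<Prod>i<n. Var i) \<in> forms n n"
proof -
  let ?e = "\<Sum>i<n. Poly_Mapping.single i (1::nat)"
  have lookup: "Poly_Mapping.lookup ?e i = (if i < n then 1 else 0)" for i
    by (auto simp: lookup_sum lookup_single when_def)
  then have keys: "Poly_Mapping.keys ?e \<subseteq> {..<n}"
    by (auto simp: in_keys_iff split: if_splits)
  have "mdegree ?e = n"
    unfolding mdegree_superset[OF finite_lessThan keys] lookup by simp
  then have "?e \<in> monomials n n"
    using keys by (simp add: monomials_def)
  moreover have "Poly_Mapping.keys (\<Prod>i<n. Var i) \<subseteq> {?e}"
    unfolding subset_iff in_keys_iff lookup_prod_Var by auto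
  ultimately show ?thesis
    unfolding forms_def by blast
qed

lemma det_flattening_prod_Var:
  assumes N: "N = card (flattening_index m)" and h: "bij_betw h {0..<N} (flattening_index m)"
  shows "det (mat N N (\<lambda>(p, q). flattening m (\<Prod>i<Suc m. Var i) (h p) (h q))) \<noteq> (0 :: 'a::field_char_0)"
proof -
  let ?f = "\<Prod>i<Suc m. Var i :: (nat, 'a) mpoly"
  let ?one = "\<Sum>i<Suc m. Poly_Mapping.single i (1::nat)"
  let ?d = "\<lambda>x. (\<Prod>i<Suc m. sign_of (fst x) i) / of_nat (multinomial_coeff (Suc m) ?one) :: 'a"
  let ?A = "mat N N (\<lambda>(p, q). flattening m ?f (h p) (h q))"
  have mem: "snd (h p) \<in> base_exps m" if "p < N" for p
  proof -
    have "h p \<in> flattening_index m"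
      using bij_betwE[OF h] that by simp
    then show ?thesis
      by (simp add: flattening_index_def mem_Times_iff)
  qed
  have entry: "flattening m ?f (h p) (h q) = (if p = q then ?d (h p) else 0)" if "p < N" "q < N" for p q
  proof -
    have "h p = h q \<longleftrightarrow> p = q"
      using bij_betw_imp_inj_on[OF h] that by (auto simp: inj_on_def)
    then show ?thesis
      unfolding flattening_prod_Var[OF mem[OF that(1)] mem[OF that(2)]] by (simp only:)
  qed
  have "mdegree ?one = Suc m"
  proof -
    have "?one \<in> monomials (Suc m) (Suc m)"
      using prod_Var_in_forms[of "Suc m", where 'a = 'a] unfolding forms_def subset_iff in_keys_iff lookup_prod_Var mem_Collect_eq by (metis one_neq_zero)
    then show ?thesis
      by (simp add: monomials_def)
  qed
  then have "of_nat (multinomial_coeff (Suc m) ?one) \<noteq> (0 :: 'a)"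
    unfolding of_nat_eq_0_iff by (rule gr_implies_not0[OF multinomial_coeff_pos])
  moreover have "(\<Prod>i<Suc m. sign_of D i :: 'a) \<noteq> 0" for D
    unfolding prod_zero_iff[OF finite_lessThan] by (auto simp: sign_of_def)
  ultimately have d: "?d x \<noteq> 0" for x
    unfolding divide_eq_0_iff by blast
  have "upper_triangular ?A"
    unfolding upper_triangular_def by (auto simp del: prod.lessThan_Suc simp: entry)
  then have "det ?A = prod_list (diag_mat ?A)"
    by (rule det_upper_triangular[where n = N]) simp
  also have "\<dots> \<noteq> 0"
  proof -
    have "x \<noteq> 0" if x: "x \<in> set (diag_mat ?A)" for x
    proof -
      obtain p where p: "p < N" "x = ?A $$ (p, p)"
        using x by (auto simp: diag_mat_def simp del: prod.lessThan_Suc)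
      then have "x = ?d (h p)"
        by (simp add: entry del: prod.lessThan_Suc sum.lessThan_Suc)
      with d show ?thesis by (simp only: not_False_eq_True)
    qed
    then show ?thesis
      unfolding prod_list_zero_iff by blast
  qed
  finally show ?thesis .
qed

text \<open>
  The determinant of the flattening separates the monomial from the forms of rank at most \<open>r\<close>.
\<close>

lemma prod_Var_notin_closure:
  assumes r: "r < 2 ^ m"
  shows "(\<Prod>i<Suc m. Var i :: (nat, 'a::field_char_0) mpoly) \<notin>
    zariski_closure (Suc m) (Suc m) {g \<in> forms (Suc m) (Suc m). waring_rank (Suc m) (Suc m) g \<le> enat r}"
proof
  let ?n = "Suc m"
  let ?f = "\<Prod>i<?n. Var i :: (nat, 'a) mpoly"
  let ?S = "{g \<in> forms ?n ?n. waring_rank ?n ?n g \<le> enat r} :: (nat, 'a) mpoly set"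
  assume f: "?f \<in> zariski_closure ?n ?n ?S"
  define N where "N = card (flattening_index m)"
  obtain h where h: "bij_betw h {0..<N} (flattening_index m)"
    unfolding N_def using ex_bij_betw_nat_finite[OF finite_flattening_index] by blast
  have mem: "h p \<in> flattening_index m" if "p < N" for p
    using bij_betwE[OF h] that by simp
  define A where "A = mat N N (\<lambda>(p, q). flattening_poly m (h p) (h q) :: (nat \<Rightarrow>\<^sub>0 nat, 'a) mpoly)"
  define P where "P = det A"
  have eval: "mpoly_eval (Poly_Mapping.lookup g) P = det (mat N N (\<lambda>(p, q). flattening m g (h p) (h q)))" for g
  proof -
    have "map_mat (mpoly_eval (Poly_Mapping.lookup g)) A = mat N N (\<lambda>(p, q). flattening m g (h p) (h q))"
      by (rule eq_matI) (simp_all add: A_def mpoly_eval_flattening_poly)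
    then show ?thesis
      unfolding P_def using comm_ring_hom.hom_det[OF mpoly_eval_hom, of "Poly_Mapping.lookup g" A] by simp
  qed
  have "P \<in> polys_in (monomials ?n ?n)"
    unfolding P_def by (rule polys_in_det[of _ N]) (simp_all add: A_def flattening_poly_polys_in)
  then have closed: "zariski_closed ?n ?n {g \<in> forms ?n ?n. mpoly_eval (Poly_Mapping.lookup g) P = 0}"
    by (rule zariski_closed_hypersurface)
  have "mpoly_eval (Poly_Mapping.lookup g) P = 0" if g: "waring_rank ?n ?n g \<le> enat r" for g :: "(nat, 'a) mpoly"
  proof -
    obtain s a c where s: "s \<le> r" "g = (\<Sum>j<s. Const (a j) * (\<Sum>i<?n. Const (c j i) * Var i) ^ ?n)"
      using g by (rule waring_rank_leD)
    show ?thesis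
      unfolding eval s(2) flattening_sum_powers
      using s(1) r by (intro det_twisted_eq_0 N_def mem) auto
  qed
  then have "?S \<subseteq> {g \<in> forms ?n ?n. mpoly_eval (Poly_Mapping.lookup g) P = 0}"
    by blast
  with f closed have "mpoly_eval (Poly_Mapping.lookup ?f) P = 0"
    unfolding zariski_closure_def by blast
  then show False
    unfolding eval using det_flattening_prod_Var[OF N_def h] by blast
qed

section \<open>The upper bound\<close>

lemma lookup_linear_form_power_outside:
  fixes c :: "nat \<Rightarrow> 'a::comm_ring_1"
  assumes "e \<notin> monomials n d"
  shows "Poly_Mapping.lookup ((\<Sum>i<n. Const (c i) * Var i) ^ d) e = 0"
  using assms
proof (induction d arbitrary: e)
  case 0
  then have "e \<noteq> 0"
    by (auto simp: monomials_def mdegree_def)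
  then show ?case
    by (simp add: lookup_one when_def)
next
  case (Suc d)
  let ?l = "\<Sum>i<n. Const (c i) * Var i"
  have "Poly_Mapping.lookup (Var i * ?l ^ d) e = 0" if i: "i < n" for i
  proof (cases "Poly_Mapping.lookup e i = 0")
    case False
    let ?e = "e - Poly_Mapping.single i 1"
    have e: "Poly_Mapping.lookup e v = Poly_Mapping.lookup ?e v + (if v = i then 1 else 0)" for v
      using False by (auto simp: lookup_minus lookup_single when_def)
    have "?e \<notin> monomials n d"
    proof
      assume *: "?e \<in> monomials n d"
      have keys: "Poly_Mapping.keys e \<subseteq> {..<n}"
      proof
        fix v assume "v \<in> Poly_Mapping.keys e"
        then have "v = i \<or> v \<in> Poly_Mapping.keys ?e"
          using e[of v] by (auto simp: in_keys_iff split: if_splits)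
        then show "v \<in> {..<n}"
          using * i by (auto simp: monomials_def)
      qed
      have keys': "Poly_Mapping.keys ?e \<subseteq> {..<n}" and "mdegree ?e = d"
        using * by (auto simp: monomials_def)
      have "mdegree e = (\<Sum>v<n. Poly_Mapping.lookup ?e v + (if v = i then 1 else 0))"
        unfolding mdegree_superset[OF finite_lessThan keys] by (intro sum.cong refl e)
      also have "\<dots> = mdegree ?e + 1"
        unfolding sum.distrib mdegree_superset[OF finite_lessThan keys'] using i by simp
      finally have "mdegree e = Suc d"
        using \<open>mdegree ?e = d\<close> by simp
      then show False
        using Suc.prems keys by (simp add: monomials_def)
    qed
    then show ?thesis
      using False Suc.IH by (simp add: lookup_Var_mult)
  qed (simp add: lookup_Var_mult)
  then have "(\<Sum>i<n. c i * Poly_Mapping.lookup (Var i * ?l ^ d) e) = 0"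
    by (intro sum.neutral ballI) simp
  then show ?case
    by (simp only: power_Suc sum_distrib_right mult.assoc lookup_sum lookup_Const_mult)
qed

text \<open>
  The sum over all signs factors over the variables, and a variable with even exponent contributes \<open>1 - 1\<close>.
\<close>

lemma sum_signs_over_subsets:
  fixes e :: "nat \<Rightarrow> nat"
  shows "(\<Sum>D\<in>Pow {1..<Suc m}. \<Prod>i<Suc m. sign_of D i ^ Suc (e i)) =
    (if \<forall>i\<in>{1..<Suc m}. odd (e i) then 2 ^ m else 0 :: 'a::comm_ring_1)"
proof -
  have "(\<Sum>D\<in>Pow {1..<Suc m}. \<Prod>i<Suc m. sign_of D i ^ Suc (e i)) =
      (\<Sum>D\<in>Pow {1..<Suc m}. (\<Prod>i\<in>D. (-1) ^ Suc (e i)) * (\<Prod>i\<in>{1..<Suc m} - D. 1 :: 'a))"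
  proof (rule sum.cong[OF refl])
    fix D assume "D \<in> Pow {1..<Suc m}"
    then have "D \<subseteq> {..<Suc m}"
      by auto
    have "(\<Prod>i<Suc m. sign_of D i ^ Suc (e i)) = (\<Prod>i<Suc m. if i \<in> D then (-1) ^ Suc (e i) else 1 :: 'a)"
      by (intro prod.cong refl) (simp add: sign_of_def)
    also have "\<dots> = (\<Prod>i\<in>D. (-1) ^ Suc (e i))"
      by (rule prod_if_subset[OF \<open>D \<subseteq> {..<Suc m}\<close>, symmetric])
    finally show "(\<Prod>i<Suc m. sign_of D i ^ Suc (e i)) = (\<Prod>i\<in>D. (-1) ^ Suc (e i)) * (\<Prod>i\<in>{1..<Suc m} - D. 1 :: 'a)"
      by simp
  qed
  also have "\<dots> = (\<Prod>i\<in>{1..<Suc m}. (-1) ^ Suc (e i) + 1)"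
    by (rule prod_add[symmetric]) simp
  also have "\<dots> = (if \<forall>i\<in>{1..<Suc m}. odd (e i) then 2 ^ m else 0)"
  proof (cases "\<forall>i\<in>{1..<Suc m}. odd (e i)")
    case True
    then have "(\<Prod>i\<in>{1..<Suc m}. (-1) ^ Suc (e i) + 1) = (\<Prod>i\<in>{1..<Suc m}. 2 :: 'a)"
      by (intro prod.cong refl) simp
    with True show ?thesis by simp
  next
    case False
    then obtain i where "i \<in> {1..<Suc m}" "(-1) ^ Suc (e i) + 1 = (0 :: 'a)"
      by auto
    then have "(\<Prod>i\<in>{1..<Suc m}. (-1) ^ Suc (e i) + 1) = (0 :: 'a)"
      by (intro prod_zero) auto
    with False show ?thesis by (simp only: if_False)
  qed
  finally show ?thesis .
qed

text \<open>
  The exponent at \<open>0\<close> is determined by the others: they are \<open>m\<close> odd numbers with sum at most \<open>m + 1\<close>, so by parity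
  their sum is \<open>m\<close>.
\<close>

lemma all_odd_iff_squarefree:
  assumes e: "e \<in> monomials (Suc m) (Suc m)"
  shows "(\<forall>i\<in>{1..<Suc m}. odd (Poly_Mapping.lookup e i)) \<longleftrightarrow> e = (\<Sum>i<Suc m. Poly_Mapping.single i 1)"
proof
  let ?one = "\<Sum>i<Suc m. Poly_Mapping.single i (1::nat)"
  let ?e = "Poly_Mapping.lookup e"
  have one: "Poly_Mapping.lookup ?one i = (if i < Suc m then 1 else 0)" for i
    unfolding lookup_sum by (auto simp: lookup_single when_def simp del: sum.lessThan_Suc)
  have keys: "Poly_Mapping.keys e \<subseteq> {..<Suc m}"
    using e by (simp add: monomials_def)
  have "(\<Sum>i<Suc m. ?e i) = Suc m"
    using e mdegree_superset[OF finite_lessThan keys] by (simp add: monomials_def)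
  moreover have "{..<Suc m} = insert 0 {1..<Suc m}"
    by auto
  ultimately have deg: "?e 0 + (\<Sum>i\<in>{1..<Suc m}. ?e i) = Suc m"
    by simp
  {
    assume odd: "\<forall>i\<in>{1..<Suc m}. odd (?e i)"
    define b where "b i = ?e i div 2" for i
    have b: "?e i = 2 * b i + 1" if "i \<in> {1..<Suc m}" for i
      using odd that by (simp add: b_def)
    have "(\<Sum>i\<in>{1..<Suc m}. ?e i) = (\<Sum>i\<in>{1..<Suc m}. 2 * b i + 1)"
      by (intro sum.cong refl b)
    also have "\<dots> = 2 * (\<Sum>i\<in>{1..<Suc m}. b i) + m"
      unfolding sum.distrib sum_distrib_left by simp
    finally have "(\<Sum>i\<in>{1..<Suc m}. ?e i) = 2 * (\<Sum>i\<in>{1..<Suc m}. b i) + m" .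
    with deg have "?e 0 + 2 * (\<Sum>i\<in>{1..<Suc m}. b i) = 1"
      by simp
    then have e0: "?e 0 = 1" and "(\<Sum>i\<in>{1..<Suc m}. b i) = 0"
      by presburger+
    then have "b i = 0" if "i \<in> {1..<Suc m}" for i
      using that by (simp only: sum_eq_0_iff finite_atLeastLessThan)
    then have "?e i = 1" if "i < Suc m" for i
      using b[of i] e0 that by (cases "i = 0") simp_all
    moreover have "?e i = 0" if "\<not> i < Suc m" for i
      using keys that by (auto simp: in_keys_iff)
    ultimately show "e = ?one"
      by (intro poly_mapping_eqI, unfold one) simp
  }
  {
    assume "e = ?one"
    then have "?e i = 1" if "i \<in> {1..<Suc m}" for i
      using that by (simp only: one) simp
    then show "\<forall>i\<in>{1..<Suc m}. odd (?e i)"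
      by simp
  }
qed

text \<open>
  Averaging the powers over the signs of \<open>x\<^sub>1, \<dots>, x\<^sub>m\<close> kills every monomial in which one of these variables has an even
  exponent. Only the squarefree monomial survives.
\<close>

lemma prod_Var_eq_sum_powers:
  "(\<Prod>i<Suc m. Var i :: (nat, 'a::field_char_0) mpoly) =
     (\<Sum>D\<in>Pow {1..<Suc m}.
        Const ((\<Prod>i<Suc m. sign_of D i) /
          (2 ^ m * of_nat (multinomial_coeff (Suc m) (\<Sum>i<Suc m. Poly_Mapping.single i 1)))) *
        (\<Sum>i<Suc m. Const (sign_of D i) * Var i) ^ Suc m)" (is "_ = ?R")
proof (rule poly_mapping_eqI)
  fix e
  let ?n = "Suc m"
  let ?one = "\<Sum>i<?n. Poly_Mapping.single i (1::nat)"
  let ?\<mu> = "\<lambda>e. of_nat (multinomial_coeff ?n e) :: 'a"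
  have one: "?one \<in> monomials ?n ?n"
    using prod_Var_in_forms[of ?n, where 'a = 'a]
    unfolding forms_def subset_iff in_keys_iff lookup_prod_Var mem_Collect_eq by (metis one_neq_zero)
  show "Poly_Mapping.lookup (\<Prod>i<?n. Var i :: (nat, 'a) mpoly) e = Poly_Mapping.lookup ?R e"
  proof (cases "e \<in> monomials ?n ?n")
    case True
    then have keys: "Poly_Mapping.keys e \<subseteq> {..<?n}"
      by (simp add: monomials_def)
    have "mdegree ?one = ?n"
      using one by (simp add: monomials_def)
    then have \<mu>: "?\<mu> ?one \<noteq> 0"
      unfolding of_nat_eq_0_iff by (rule gr_implies_not0[OF multinomial_coeff_pos])
    have "Poly_Mapping.lookup ?R e = (\<Sum>D\<in>Pow {1..<?n}. (\<Prod>i<?n. sign_of D i) / (2 ^ m * ?\<mu> ?one) *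
        (?\<mu> e * (\<Prod>i<?n. sign_of D i ^ Poly_Mapping.lookup e i)))"
      unfolding lookup_sum lookup_Const_mult lookup_linear_form_power[OF keys] ..
    also have "\<dots> = (\<Sum>D\<in>Pow {1..<?n}. ?\<mu> e / (2 ^ m * ?\<mu> ?one) * (\<Prod>i<?n. sign_of D i ^ Suc (Poly_Mapping.lookup e i)))"
      unfolding power_Suc prod.distrib
      by (intro sum.cong refl) (simp only: times_divide_eq_left times_divide_eq_right mult_ac)
    also have "\<dots> = ?\<mu> e / (2 ^ m * ?\<mu> ?one) * (if e = ?one then 2 ^ m else 0)"
      unfolding sum_distrib_left[symmetric] sum_signs_over_subsets all_odd_iff_squarefree[OF True] ..
    also have "\<dots> = (if e = ?one then 1 else 0)"
      using \<mu> by (cases "e = ?one") (simp_all only: simp_thms if_True if_False mult_zero_right, simp)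
    finally show ?thesis
      unfolding lookup_prod_Var ..
  next
    case False
    then have "e \<noteq> ?one"
      using one by metis
    then show ?thesis
      unfolding lookup_prod_Var lookup_sum lookup_Const_mult lookup_linear_form_power_outside[OF False]
      by (simp only: if_False mult_zero_right sum.neutral_const)
  qed
qed

lemma linear_form_in_forms: "(\<Sum>i<n. Const (c i) * Var i) \<in> forms n 1"
proof -
  have "Poly_Mapping.lookup ((\<Sum>i<n. Const (c i) * Var i) ^ 1) e = 0" if "e \<notin> monomials n 1" for e
    using that by (rule lookup_linear_form_power_outside)
  then show ?thesis
    unfolding forms_def by (auto simp: in_keys_iff)
qed

lemma waring_rank_prod_Var_le:
  "waring_rank (Suc m) (Suc m) (\<Prod>i<Suc m. Var i :: (nat, 'a::field_char_0) mpoly) \<le> enat (2 ^ m)"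
proof -
  let ?n = "Suc m"
  let ?f = "\<Prod>i<?n. Var i :: (nat, 'a) mpoly"
  let ?K = "Pow {1..<?n}"
  have card: "card ?K = 2 ^ m"
    by (simp add: card_Pow)
  have "finite ?K"
    by simp
  from ex_bij_betw_nat_finite[OF this] obtain h where h: "bij_betw h {0..<2 ^ m :: nat} ?K"
    unfolding card by blast
  let ?a = "\<lambda>D. (\<Prod>i<?n. sign_of D i) / (2 ^ m * of_nat (multinomial_coeff ?n (\<Sum>i<?n. Poly_Mapping.single i 1))) :: 'a"
  let ?l = "\<lambda>D. \<Sum>i<?n. Const (sign_of D i) * Var i :: (nat, 'a) mpoly"
  have "?f = (\<Sum>D\<in>?K. Const (?a D) * ?l D ^ ?n)"
    by (rule prod_Var_eq_sum_powers)
  also have "\<dots> = (\<Sum>j\<in>{0..<2 ^ m}. Const (?a (h j)) * ?l (h j) ^ ?n)"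
    by (rule sum.reindex_bij_betw[OF h, symmetric])
  finally have f: "?f = (\<Sum>j<2 ^ m. Const (?a (h j)) * ?l (h j) ^ ?n)"
    unfolding atLeast0LessThan .
  have "\<exists>a l. (\<forall>j<(2::nat) ^ m. l j \<in> forms ?n 1) \<and> ?f = (\<Sum>j<(2::nat) ^ m. Const (a j) * l j ^ ?n)"
    by (intro exI[of _ "\<lambda>j. ?a (h j)"] exI[of _ "\<lambda>j. ?l (h j)"] conjI allI impI linear_form_in_forms f)
  then show ?thesis
    unfolding waring_rank_def by (intro Inf_lower CollectI exI[of _ "2 ^ m"] conjI refl)
qed

lemma border_waring_rank_prod_Var:
  "border_waring_rank (Suc m) (Suc m) (\<Prod>i<Suc m. Var i :: (nat, 'a::field_char_0) mpoly) = 2 ^ m"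
proof -
  let ?n = "Suc m"
  let ?f = "\<Prod>i<?n. Var i :: (nat, 'a) mpoly"
  let ?C = "\<lambda>r. zariski_closure ?n ?n {g \<in> forms ?n ?n. waring_rank ?n ?n g \<le> enat r}"
  have "?f \<in> ?C (2 ^ m)"
    unfolding zariski_closure_def using prod_Var_in_forms waring_rank_prod_Var_le by blast
  then have upper: "border_waring_rank ?n ?n ?f \<le> enat (2 ^ m)"
    unfolding border_waring_rank_def by (intro Inf_lower CollectI exI[of _ "2 ^ m"] conjI refl)
  have "2 ^ m \<le> r" if "?f \<in> ?C r" for r
    using that prod_Var_notin_closure[of r m] not_le by blast
  then have "enat (2 ^ m) \<le> border_waring_rank ?n ?n ?f"
    unfolding border_waring_rank_def by (intro Inf_greatest) (auto simp del: prod.lessThan_Suc)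
  with upper have "border_waring_rank ?n ?n ?f = enat (2 ^ m)"
    by (rule antisym)
  also have "enat (2 ^ m) = 2 ^ m"
    by (metis of_nat_eq_enat of_nat_numeral of_nat_power)
  finally show ?thesis .
qed

lemma tensor_to_form_perm_tensor:
  "tensor_to_form n n (perm_tensor n :: 'a::field_char_0 tensor) = (\<Prod>i<n. Var i)"
  unfolding tensor_to_form_def
proof (rule the_equality)
  show "(\<Prod>i<n. Var i :: (nat, 'a) mpoly) \<in> forms n n \<and> form_to_tensor n (\<Prod>i<n. Var i) = (perm_tensor n :: 'a tensor)"
    using prod_Var_in_forms form_to_tensor_prod_Var by blast
  show "f = (\<Prod>i<n. Var i)" if "f \<in> forms n n \<and> form_to_tensor n f = (perm_tensor n :: 'a tensor)" for f :: "(nat, 'a) mpoly"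
    using that prod_Var_in_forms form_to_tensor_prod_Var form_to_tensor_inj by (metis inj_onD)
qed

theorem theorem1:
  fixes n :: nat
  assumes "n \<ge> 1"
  shows "border_waring_rank n n (\<Prod>i<n. Var i :: (nat, 'a::field_char_0) mpoly) = 2 ^ (n - 1)
       \<and> tensor_border_waring_rank n n (perm_tensor n :: 'a tensor) = 2 ^ (n - 1)"
proof -
  obtain m where n: "n = Suc m"
    using assms by (cases n) auto
  have "border_waring_rank n n (\<Prod>i<n. Var i :: (nat, 'a) mpoly) = 2 ^ (n - 1)"
    unfolding n diff_Suc_1 by (rule border_waring_rank_prod_Var)
  then show ?thesis
    unfolding tensor_border_waring_rank_def tensor_to_form_perm_tensor by blast
qed

end
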